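(* Let $\ell>0$ and let $F,S\in\mathbb{R}$ satisfy $$0<3|F|\leqslant(2S)^{3/2}.$$ Then there exists a bounded nonzero stationary (time-independent) weak solution $u$ of $$\left[u-\ell^2u_{xx}\right]_t+\left[\tfrac12u^2-\ell^2u\,u_{xx}-\tfrac12\ell^2u_x^2\right]_x=0$$ with momentum flux $S$ and globally constant energy flux $F$, having the form $$u(x)=\eta(|x|/\ell)\,\operatorname{sgn}F\qquad\text{for }|x|\leqslant x_*\ell .$$ Here one has equality $3|F|=(2S)^{3/2}$ for cuspons (for which $x_*=+\infty$ and the formula holds for all $x\in\mathbb{R}$) and strict inequality $3|F|<(2S)^{3/2}$ for periodic cuspons (for which $x_*<\infty$ and $u$ is extended periodically with period $2x_*\ell$). All these cuspons and periodic cuspons are conservative solutions of the regularised Burgers equation.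
   Context: Fluxes. For a stationary solution the momentum flux is $S=\tfrac12u^2-\ell^2u\,u_{xx}-\tfrac12\ell^2u_x^2=\tfrac12u^2+\ell^2P$ and the energy flux is $F=\tfrac13u^3-\ell^2u^2u_{xx}=\tfrac13u^3+\ell^2uP+\tfrac12\ell^2u\,u_x^2$, where $P=\mathfrak{G}\ast\tfrac12u_x^2$, $\mathfrak{G}(x)=(2\ell)^{-1}e^{-|x|/\ell}$. Where $u\neq0$ they give $\tfrac12\ell^2u\,u_x^2=F-Su+\tfrac16u^3$. The profile $\eta$. Let $u_1\geqslant u_0>0$ be determined by $$|F|=\tfrac16u_0u_1(u_0+u_1),\qquad S=\tfrac16(u_0^2+u_0u_1+u_1^2),$$ let $$H(\eta)=\int_0^\eta\left(\frac{3v}{(u_0-v)(u_1-v)(u_0+u_1+v)}\right)^{1/2}\mathrm{d}v,\qquad x_*=H(u_0)\in(0,+\infty],$$ and let $\eta(x)$, $0\leqslant x<x_*$, be defined implicitly by $H(\eta(x))=x$ (with $\eta(x_* )=u_0$ if $x_*<\infty$). If $u_0<u_1$ then $x_*<\infty$; the solution $u$, equal to $\eta(|x|/\ell)\operatorname{sgn}F$ on $|x|\leqslant x_*\ell$ and extended with period $2x_*\ell$, is called a periodic cuspon. If $u_0=u_1$ then $x_*=+\infty$, and the solution $u(x)=\eta(|x|/\ell)\operatorname{sgn}F$ is called a cuspon ($|u|\to u_0$ as $x\to\pm\infty$). Conservative solution. A function $u(t,x)$ is a conservative solution of the regularised Burgers equation $u_t+uu_x+\ell^2P_x=0$ with initial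 datum $u_0$ (here an initial function) if: (i) $u\in\mathrm{Lip}([0,T],L^2_{\rm loc})$ and $u_x\in L^\infty([0,T],L^2_{\rm loc})$ for all $T>0$; (ii) $u$ satisfies $u_t+uu_x+\ell^2P_x=0$ weakly with that initial datum; (iii) $\left[\tfrac12u^2+\tfrac12\ell^2u_x^2\right]_t+\left[\tfrac13u^3+\ell^2uP+\tfrac12\ell^2u\,u_x^2\right]_x=0$ in the sense of distributions. *)

theory Defs
  imports "HOL-Analysis.Analysis"
begin

text \<open>Test functions. The functions involved are defined on the line or on the plane of points
  \<open>(t, x)\<close>; a function is \<open>C\<^sup>k\<^sup>+\<^sup>1\<close> if it is differentiable with all partial derivatives \<open>C\<^sup>k\<close>.\<close>

definition pderiv_dir :: "'a::euclidean_space \<Rightarrow> ('a \<Rightarrow> real) \<Rightarrow> 'a \<Rightarrow> real" where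
  "pderiv_dir b f = (\<lambda>x. frechet_derivative f (at x) b)"

abbreviation dt :: "(real \<times> real \<Rightarrow> real) \<Rightarrow> real \<times> real \<Rightarrow> real" where
  "dt \<equiv> pderiv_dir (1, 0)"

abbreviation dx :: "(real \<times> real \<Rightarrow> real) \<Rightarrow> real \<times> real \<Rightarrow> real" where
  "dx \<equiv> pderiv_dir (0, 1)"

primrec C_k :: "nat \<Rightarrow> ('a::euclidean_space \<Rightarrow> real) \<Rightarrow> bool" where
  "C_k 0 f \<longleftrightarrow> continuous_on UNIV f"
| "C_k (Suc k) f \<longleftrightarrow> f differentiable_on UNIV \<and> (\<forall>b\<in>Basis. C_k k (pderiv_dir b f))"

definition test_functions :: "'a::euclidean_space set \<Rightarrow> ('a \<Rightarrow> real) set" where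
  "test_functions \<Omega> = {\<phi>. (\<forall>k. C_k k \<phi>) \<and>
     compact (closure {x. \<phi> x \<noteq> 0}) \<and> closure {x. \<phi> x \<noteq> 0} \<subseteq> \<Omega>}"

definition L2_loc :: "(real \<Rightarrow> real) \<Rightarrow> bool" where
  "L2_loc f \<longleftrightarrow> f \<in> borel_measurable borel \<and>
     (\<forall>a b. set_integrable lborel {a..b} (\<lambda>x. (f x)\<^sup>2))"

text \<open>\<open>weak_deriv f g\<close>: \<open>f\<close> lies in \<open>H\<^sup>1\<^sub>l\<^sub>o\<^sub>c\<close> and \<open>g\<close> represents its distributional derivative.
  The function \<open>g\<close> is unique up to null sets, so an existential over \<open>g\<close> in the definitions
  below involves no choice.\<close>

definition weak_deriv :: "(real \<Rightarrow> real) \<Rightarrow> (real \<Rightarrow> real) \<Rightarrow> bool" where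
  "weak_deriv f g \<longleftrightarrow> L2_loc f \<and> L2_loc g \<and>
     (\<forall>\<psi>\<in>test_functions UNIV. (LINT x|lborel. f x * deriv \<psi> x) = - (LINT x|lborel. g x * \<psi> x))"

definition kernel :: "real \<Rightarrow> real \<Rightarrow> real" where
  "kernel l x = exp (- \<bar>x\<bar> / l) / (2 * l)"

text \<open>The convolution \<open>P\<close> of the kernel with \<open>w\<^sup>2 / 2\<close>, where \<open>w\<close> stands for \<open>u\<^sub>x\<close>. The Bochner
  integral is 0 if the integrand is not integrable, so wherever \<open>P\<close> is used the condition
  \<open>P_defined\<close> is imposed as well.\<close>

definition P :: "real \<Rightarrow> (real \<Rightarrow> real) \<Rightarrow> real \<Rightarrow> real" where
  "P l w x = (LINT y|lborel. kernel l (x - y) * ((w y)\<^sup>2 / 2))"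

definition P_defined :: "real \<Rightarrow> (real \<Rightarrow> real) \<Rightarrow> real \<Rightarrow> bool" where
  "P_defined l w x \<longleftrightarrow> integrable lborel (\<lambda>y. kernel l (x - y) * ((w y)\<^sup>2 / 2))"

text \<open>Weak solutions \<open>u(t,x)\<close> of
  \<open>[u - l\<^sup>2 u\<^sub>x\<^sub>x]\<^sub>t + [u\<^sup>2/2 - l\<^sup>2 u u\<^sub>x\<^sub>x - l\<^sup>2 u\<^sub>x\<^sup>2/2]\<^sub>x = 0\<close> for all times \<open>t\<close>, with \<open>v\<close> for \<open>u\<^sub>x\<close>.
  Second derivatives are read as distributions, \<open>u u\<^sub>x\<^sub>x = (u u\<^sub>x)\<^sub>x - u\<^sub>x\<^sup>2\<close>, so that the flux is
  \<open>u\<^sup>2/2 - l\<^sup>2 (u u\<^sub>x)\<^sub>x + l\<^sup>2 u\<^sub>x\<^sup>2/2\<close>.\<close>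

definition weak_solution :: "real \<Rightarrow> (real \<Rightarrow> real \<Rightarrow> real) \<Rightarrow> bool" where
  "weak_solution l u \<longleftrightarrow> (\<exists>v.
     case_prod u \<in> borel_measurable borel \<and> case_prod v \<in> borel_measurable borel \<and>
     (\<forall>K. compact K \<longrightarrow> set_integrable lborel K (\<lambda>(t, x). (u t x)\<^sup>2) \<and>
                        set_integrable lborel K (\<lambda>(t, x). (v t x)\<^sup>2)) \<and>
     (AE t in lborel. weak_deriv (u t) (v t)) \<and>
     (\<forall>\<phi>\<in>test_functions UNIV.
        (LINT (t, x)|lborel.
           u t x * dt \<phi> (t, x) + l\<^sup>2 * v t x * dx (dt \<phi>) (t, x)
           + ((u t x)\<^sup>2 / 2 + l\<^sup>2 * (v t x)\<^sup>2 / 2) * dx \<phi> (t, x)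
           + l\<^sup>2 * u t x * v t x * dx (dx \<phi>) (t, x)) = 0))"

text \<open>Fluxes of a stationary solution \<open>u(x)\<close>, in both forms: the one involving \<open>u\<^sub>x\<^sub>x\<close>, read as a
  distribution, and the one involving \<open>P\<close>. For the energy flux,
  \<open>u\<^sup>2 u\<^sub>x\<^sub>x = (u\<^sup>2 u\<^sub>x)\<^sub>x - 2 u u\<^sub>x\<^sup>2\<close>.\<close>

definition momentum_flux :: "real \<Rightarrow> (real \<Rightarrow> real) \<Rightarrow> real \<Rightarrow> bool" where
  "momentum_flux l u S \<longleftrightarrow> (\<exists>w. weak_deriv u w \<and>
     (\<forall>\<psi>\<in>test_functions UNIV.
        (LINT x|lborel. ((u x)\<^sup>2 / 2 + l\<^sup>2 * (w x)\<^sup>2 / 2) * \<psi> x + l\<^sup>2 * u x * w x * deriv \<psi> x)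
        = (LINT x|lborel. S * \<psi> x)) \<and>
     (\<forall>x. P_defined l w x \<and> (u x)\<^sup>2 / 2 + l\<^sup>2 * P l w x = S))"

definition energy_flux :: "real \<Rightarrow> (real \<Rightarrow> real) \<Rightarrow> real \<Rightarrow> bool" where
  "energy_flux l u F \<longleftrightarrow> (\<exists>w. weak_deriv u w \<and>
     (\<forall>\<psi>\<in>test_functions UNIV.
        (LINT x|lborel. ((u x)^3 / 3 + 2 * l\<^sup>2 * u x * (w x)\<^sup>2) * \<psi> x
                        + l\<^sup>2 * (u x)\<^sup>2 * w x * deriv \<psi> x)
        = (LINT x|lborel. F * \<psi> x)) \<and>
     (AE x in lborel. P_defined l w x \<and>
        (u x)^3 / 3 + l\<^sup>2 * u x * P l w x + l\<^sup>2 * u x * (w x)\<^sup>2 / 2 = F))"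

text \<open>\<open>Lip([0,T], L\<^sup>2\<^sub>l\<^sub>o\<^sub>c)\<close> and \<open>L\<^sup>\<infinity>([0,T], L\<^sup>2\<^sub>l\<^sub>o\<^sub>c)\<close> refer to the seminorms
  of \<open>L\<^sup>2([a,b])\<close>.\<close>

definition Lip_L2_loc :: "real \<Rightarrow> (real \<Rightarrow> real \<Rightarrow> real) \<Rightarrow> bool" where
  "Lip_L2_loc T u \<longleftrightarrow> (\<forall>t\<in>{0..T}. L2_loc (u t)) \<and>
     (\<forall>a b. \<exists>C. \<forall>s\<in>{0..T}. \<forall>t\<in>{0..T}.
        sqrt (LINT x:{a..b}|lborel. (u t x - u s x)\<^sup>2) \<le> C * \<bar>t - s\<bar>)"

definition Linf_L2_loc :: "real \<Rightarrow> (real \<Rightarrow> real \<Rightarrow> real) \<Rightarrow> bool" where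
  "Linf_L2_loc T v \<longleftrightarrow> (\<forall>a b. \<exists>C. AE t in lborel. t \<in> {0..T} \<longrightarrow>
     L2_loc (v t) \<and> sqrt (LINT x:{a..b}|lborel. (v t x)\<^sup>2) \<le> C)"

text \<open>Conservative solutions \<open>u(t,x)\<close>, \<open>t \<ge> 0\<close>, with initial datum \<open>ui\<close>; \<open>v\<close> stands for \<open>u\<^sub>x\<close>.
  The initial datum enters through test functions that need not vanish at \<open>t = 0\<close>. The
  integrability conditions say that the terms of the two equations are distributions.\<close>

definition conservative_solution ::
    "real \<Rightarrow> (real \<Rightarrow> real) \<Rightarrow> (real \<Rightarrow> real \<Rightarrow> real) \<Rightarrow> bool" where
  "conservative_solution l ui u \<longleftrightarrow> (\<exists>v.
     L2_loc ui \<and>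
     set_borel_measurable borel ({0..} \<times> UNIV) (case_prod u) \<and>
     case_prod v \<in> borel_measurable borel \<and>
     (AE t in lborel. 0 \<le> t \<longrightarrow> weak_deriv (u t) (v t)) \<and>
     (\<forall>T>0. Lip_L2_loc T u \<and> Linf_L2_loc T v) \<and>
     (AE (t, x) in lborel. 0 \<le> t \<longrightarrow> P_defined l (v t) x) \<and>
     (\<forall>K. compact K \<and> K \<subseteq> {0..} \<times> UNIV \<longrightarrow>
        set_integrable lborel K (\<lambda>(t, x). (u t x)\<^sup>2 / 2 + l\<^sup>2 * P l (v t) x) \<and>
        set_integrable lborel K (\<lambda>(t, x). (u t x)\<^sup>2 / 2 + l\<^sup>2 * (v t x)\<^sup>2 / 2) \<and>
        set_integrable lborel K (\<lambda>(t, x). (u t x)^3 / 3 + l\<^sup>2 * u t x * P l (v t) x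
                                           + l\<^sup>2 * u t x * (v t x)\<^sup>2 / 2)) \<and>
     (\<forall>\<phi>\<in>test_functions UNIV.
        (LINT p:{0..} \<times> UNIV|lborel. (case p of (t, x) \<Rightarrow>
           u t x * dt \<phi> (t, x) + ((u t x)\<^sup>2 / 2 + l\<^sup>2 * P l (v t) x) * dx \<phi> (t, x)))
        + (LINT x|lborel. ui x * \<phi> (0, x)) = 0) \<and>
     (\<forall>\<phi>\<in>test_functions ({0<..} \<times> UNIV).
        (LINT p:{0..} \<times> UNIV|lborel. (case p of (t, x) \<Rightarrow>
           ((u t x)\<^sup>2 / 2 + l\<^sup>2 * (v t x)\<^sup>2 / 2) * dt \<phi> (t, x)
           + ((u t x)^3 / 3 + l\<^sup>2 * u t x * P l (v t) x + l\<^sup>2 * u t x * (v t x)\<^sup>2 / 2)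
             * dx \<phi> (t, x))) = 0))"

definition amplitudes :: "real \<Rightarrow> real \<Rightarrow> real \<Rightarrow> real \<Rightarrow> bool" where
  "amplitudes F S u0 u1 \<longleftrightarrow> 0 < u0 \<and> u0 \<le> u1 \<and>
     \<bar>F\<bar> = u0 * u1 * (u0 + u1) / 6 \<and> S = (u0\<^sup>2 + u0 * u1 + u1\<^sup>2) / 6"

text \<open>The integrand is nonnegative on \<open>[0, u0)\<close>; the value \<open>\<infinity>\<close> is possible at \<open>h = u0\<close>.\<close>

definition H :: "real \<Rightarrow> real \<Rightarrow> real \<Rightarrow> ennreal" where
  "H u0 u1 h = (\<integral>\<^sup>+v\<in>{0..h}.
     ennreal (sqrt (3 * v / ((u0 - v) * (u1 - v) * (u0 + u1 + v)))) \<partial>lborel)"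

definition xstar :: "real \<Rightarrow> real \<Rightarrow> ennreal" where
  "xstar u0 u1 = H u0 u1 u0"

text \<open>Only the values of \<open>\<eta>\<close> on \<open>[0, xstar)\<close>, and at \<open>xstar\<close> if this is finite, are
  constrained.\<close>

definition profile :: "real \<Rightarrow> real \<Rightarrow> (real \<Rightarrow> real) \<Rightarrow> bool" where
  "profile u0 u1 \<eta> \<longleftrightarrow>
     (\<forall>x\<ge>0. ennreal x < xstar u0 u1 \<longrightarrow> \<eta> x \<in> {0..u0} \<and> H u0 u1 (\<eta> x) = ennreal x) \<and>
     (xstar u0 u1 < \<infinity> \<longrightarrow> \<eta> (enn2real (xstar u0 u1)) = u0)"

definition cuspon :: "real \<Rightarrow> real \<Rightarrow> real \<Rightarrow> (real \<Rightarrow> real) \<Rightarrow> bool" where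
  "cuspon l F S u \<longleftrightarrow> (\<exists>u0 u1 \<eta>. amplitudes F S u0 u1 \<and> u0 = u1 \<and> profile u0 u1 \<eta> \<and>
     (\<forall>x. u x = \<eta> (\<bar>x\<bar> / l) * sgn F))"

definition periodic_cuspon :: "real \<Rightarrow> real \<Rightarrow> real \<Rightarrow> (real \<Rightarrow> real) \<Rightarrow> bool" where
  "periodic_cuspon l F S u \<longleftrightarrow> (\<exists>u0 u1 \<eta>. amplitudes F S u0 u1 \<and> u0 < u1 \<and> profile u0 u1 \<eta> \<and>
     (\<forall>x. \<bar>x\<bar> \<le> enn2real (xstar u0 u1) * l \<longrightarrow> u x = \<eta> (\<bar>x\<bar> / l) * sgn F) \<and>
     (\<forall>x. u (x + 2 * enn2real (xstar u0 u1) * l) = u x))"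

end

theory Submission
  imports Defs
begin

text \<open>
  Multiplying the profile equation by \<open>u\<^sup>2\<close> turns it into a polynomial identity for
  \<open>m = u u\<^sub>x\<close>, namely \<open>l\<^sup>2 m\<^sup>2 = u (2 F - 2 S u + u\<^sup>3 / 3)\<close>, so \<open>m\<close> extends continuously through
  the cusps although \<open>u\<^sub>x\<close> blows up there. Away from the isolated cusps and crests,
  \<open>m' = u\<^sub>x\<^sup>2 / 2 - p\<close> with \<open>p = (S - u\<^sup>2 / 2) / l\<^sup>2\<close>. Since \<open>m\<close> is continuous, this makes \<open>u\<^sub>x\<^sup>2\<close> locally
  integrable, and integration by parts over the exceptional points leaves no boundary terms: the
  distributional flux identities are those for \<open>m'\<close> and \<open>(u m)'\<close>. As \<open>p' = - m / l\<^sup>2\<close>, the function \<open>p\<close>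
  solves \<open>p - l\<^sup>2 p'' = u\<^sub>x\<^sup>2 / 2\<close> and is bounded, hence equals the convolution \<open>P\<close>. The
  time-dependent statements then follow by Fubini's theorem.
\<close>

section \<open>Locally integrable functions and integration by parts\<close>

text \<open>With \<open>v = |u|\<close>, the identity for \<open>m\<close> reads
  \<open>l^2 m^2 = K u0 u1 v\<close>, where \<open>3 * K u0 u1 v = v (v^3 - 6 S v + 6 |F|)\<close>.
  The cubic has no quadratic term, so its roots have the form u0, u1, -(u0 + u1), and the equations
  for the amplitudes are Vieta's formulas. Separating variables in
  \<open>l v v_x = sqrt (K u0 u1 v)\<close> produces the integrand of \<open>H\<close>. The order of
  its singularity at u0 decides the shape: a simple root of the cubic is reached at a finite
  distance, where the wave turns back in a crest; a double root is never reached. At a cusp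
  \<open>v\<close> grows like \<open>|x|^(2/3)\<close>, so \<open>u_x^2\<close> behaves like
  \<open>|x|^(-2/3)\<close>. These asymptotics are never computed: the gauge-integral form of the
  fundamental theorem tolerates exceptional points, and the sign of \<open>u_x^2\<close> makes its
  integral absolute. The locale \<open>stationary\<close> does not mention the profile, so the two
  kinds of waves differ only in the exceptional set and in how the line is folded onto the domain of
  the profile.\<close>

definition locally_integrable :: "(real \<Rightarrow> real) \<Rightarrow> bool" where
  "locally_integrable g \<longleftrightarrow> g \<in> borel_measurable borel \<and> (\<forall>a b. set_integrable lborel {a..b} g)"

lemma locally_integrable_measurable [measurable_dest]:
  "locally_integrable g \<Longrightarrow> g \<in> borel_measurable borel"
  by (simp add: locally_integrable_def)

lemma locally_integrableD: "locally_integrable g \<Longrightarrow> set_integrable lborel {a..b} g"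
  by (simp add: locally_integrable_def)

lemma locally_integrable_continuous:
  "continuous_on UNIV g \<Longrightarrow> locally_integrable g"
  unfolding locally_integrable_def
  by (auto intro: borel_measurable_continuous_onI borel_integrable_atLeastAtMost' continuous_on_subset)

lemma locally_integrable_add:
  "locally_integrable f \<Longrightarrow> locally_integrable g \<Longrightarrow> locally_integrable (\<lambda>x. f x + g x)"
  by (auto simp: locally_integrable_def intro: borel_measurable_add)

lemma locally_integrable_bound:
  assumes "locally_integrable f" "g \<in> borel_measurable borel" "\<And>x. \<bar>g x\<bar> \<le> \<bar>f x\<bar>"
  shows "locally_integrable g"
  unfolding locally_integrable_def
proof (intro conjI allI)
  fix a b
  show "set_integrable lborel {a..b} g"
    by (rule set_integrable_bound[OF locally_integrableD[OF assms(1), of a b]])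
      (use assms in \<open>auto simp: set_borel_measurable_def\<close>)
qed (fact assms)

lemma locally_integrable_mult_continuous:
  assumes f: "locally_integrable f" and c: "continuous_on UNIV c"
  shows "locally_integrable (\<lambda>x. c x * f x)"
  unfolding locally_integrable_def
proof (intro conjI allI)
  have [measurable]: "c \<in> borel_measurable borel" "f \<in> borel_measurable borel"
    using f c by (auto intro: borel_measurable_continuous_onI locally_integrable_measurable)
  show meas: "(\<lambda>x. c x * f x) \<in> borel_measurable borel"
    by measurable
  fix a b
  have "compact (c ` {a..b})"
    by (intro compact_continuous_image continuous_on_subset[OF c]) auto
  then obtain M where M: "\<And>x. x \<in> {a..b} \<Longrightarrow> \<bar>c x\<bar> \<le> M"
    by (metis bounded_iff compact_imp_bounded imageI real_norm_def)
  have "set_integrable lborel {a..b} (\<lambda>x. M * f x)"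
    using locally_integrableD[OF f] by simp
  then show "set_integrable lborel {a..b} (\<lambda>x. c x * f x)"
  proof (rule set_integrable_bound)
    have "\<bar>c x * f x\<bar> \<le> \<bar>M * f x\<bar>" if "x \<in> {a..b}" for x
      using M[OF that] by (auto simp: abs_mult intro!: mult_right_mono)
    then show "AE x in lborel. x \<in> {a..b} \<longrightarrow> norm (c x * f x) \<le> norm (M * f x)"
      by auto
  qed (simp add: set_borel_measurable_def)
qed

lemma locally_integrable_compact_support:
  assumes g: "locally_integrable g" and c: "continuous_on UNIV c"
    and supp: "\<And>x. a < \<bar>x\<bar> \<Longrightarrow> c x = 0"
  shows "integrable lborel (\<lambda>x. g x * c x)"
    and "(LINT x|lborel. g x * c x) = (LINT x:{-a..a}|lborel. g x * c x)"
proof -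
  have eq: "(\<lambda>x. g x * c x) = (\<lambda>x. indicator {-a..a} x *\<^sub>R (g x * c x))"
  proof
    fix x
    show "g x * c x = indicator {-a..a} x *\<^sub>R (g x * c x)"
      using supp[of x] by (cases "a < \<bar>x\<bar>") (auto simp: indicator_def abs_if split: if_splits)
  qed
  show "integrable lborel (\<lambda>x. g x * c x)"
    using locally_integrableD[OF locally_integrable_mult_continuous[OF g c], of "-a" a]
    unfolding set_integrable_def by (subst eq) (simp add: mult.commute)
  show "(LINT x|lborel. g x * c x) = (LINT x:{-a..a}|lborel. g x * c x)"
    by (subst eq) (simp add: set_lebesgue_integral_def)
qed

lemma FTC_finite_exceptions:
  fixes f g :: "real \<Rightarrow> real"
  assumes "a \<le> b" "finite (Z \<inter> {a..b})" "continuous_on {a..b} f"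
    and "\<And>x. x \<in> {a<..<b} - Z \<Longrightarrow> (f has_real_derivative g x) (at x)"
    and "set_integrable lborel {a..b} g"
  shows "(LINT x:{a..b}|lborel. g x) = f b - f a"
proof -
  have "(g has_integral (f b - f a)) {a..b}"
    by (rule fundamental_theorem_of_calculus_interior_strong[OF assms(2,1)])
      (use assms in \<open>auto simp: has_real_derivative_iff_has_vector_derivative\<close>)
  then show ?thesis
    using set_borel_integral_eq_integral(2)[OF assms(5)] by (simp add: integral_unique)
qed

text \<open>The fundamental theorem yields a gauge integral with no integrability assumption on
  \<open>g\<close>, and for a nonnegative function such an integral is absolute. In this way an
  unbounded derivative is seen to be Lebesgue integrable from the continuity of its
  primitive.\<close>

lemma FTC_nonneg_integrable:
  fixes f g :: "real \<Rightarrow> real"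
  assumes "a \<le> b" "finite (Z \<inter> {a..b})" "continuous_on {a..b} f"
    and "\<And>x. x \<in> {a<..<b} - Z \<Longrightarrow> (f has_real_derivative g x) (at x)"
    and g[measurable]: "g \<in> borel_measurable borel" and nonneg: "\<And>x. x \<in> {a..b} \<Longrightarrow> 0 \<le> g x"
  shows "set_integrable lborel {a..b} g"
proof -
  have "(g has_integral (f b - f a)) {a..b}"
    by (rule fundamental_theorem_of_calculus_interior_strong[OF assms(2,1)])
      (use assms in \<open>auto simp: has_real_derivative_iff_has_vector_derivative\<close>)
  then have "g absolutely_integrable_on {a..b}"
    using nonneg by (intro nonnegative_absolutely_integrable_1) (auto simp: integrable_on_def)
  then show ?thesis
    unfolding set_integrable_def by (subst (asm) integrable_completion) auto
qed

lemma integral_by_parts_compact_support: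
  fixes f g \<psi> \<psi>' :: "real \<Rightarrow> real"
  assumes Z: "\<And>a b. finite (Z \<inter> {a..b})"
    and f: "continuous_on UNIV f"
    and f': "\<And>x. x \<notin> Z \<Longrightarrow> (f has_real_derivative g x) (at x)"
    and g: "locally_integrable g"
    and \<psi>: "\<And>x. (\<psi> has_real_derivative \<psi>' x) (at x)" and \<psi>': "continuous_on UNIV \<psi>'"
    and supp: "\<And>x. a < \<bar>x\<bar> \<Longrightarrow> \<psi> x = 0" "\<And>x. a < \<bar>x\<bar> \<Longrightarrow> \<psi>' x = 0"
  shows "(LINT x|lborel. f x * \<psi>' x) = - (LINT x|lborel. g x * \<psi> x)"
proof -
  have cont: "continuous_on UNIV \<psi>"
    using \<psi> DERIV_isCont continuous_at_imp_continuous_on by blast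
  note lf = locally_integrable_continuous[OF f]
  \<comment> \<open>Strictly outside the support, and positive whatever the sign of
    \<open>a\<close>.\<close>
  define b where "b = \<bar>a\<bar> + 1"
  have lg: "locally_integrable (\<lambda>x. g x * \<psi> x + f x * \<psi>' x)"
    using locally_integrable_mult_continuous[OF g cont] locally_integrable_mult_continuous[OF lf \<psi>']
    by (intro locally_integrable_add) (simp_all add: mult.commute)
  have "(LINT x:{-b..b}|lborel. g x * \<psi> x + f x * \<psi>' x) = f b * \<psi> b - f (-b) * \<psi> (-b)"
  proof (rule FTC_finite_exceptions[OF _ Z])
    show "continuous_on {- b..b} (\<lambda>a. f a * \<psi> a)"
      by (intro continuous_on_mult continuous_on_subset[OF f] continuous_on_subset[OF cont]) auto
    show "((\<lambda>a. f a * \<psi> a) has_real_derivative g x * \<psi> x + f x * \<psi>' x) (at x)"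
      if "x \<in> {- b<..<b} - Z" for x
      using that by (intro DERIV_cong[OF DERIV_mult[OF f' \<psi>]]) auto
  qed (simp_all add: b_def locally_integrableD[OF lg])
  also have "\<dots> = 0"
    using supp(1)[of b] supp(1)[of "-b"] by (simp add: b_def)
  finally have 0: "(LINT x:{-b..b}|lborel. g x * \<psi> x + f x * \<psi>' x) = 0" .
  have s: "\<psi> x = 0" "\<psi>' x = 0" if "b < \<bar>x\<bar>" for x
    using that supp by (auto simp: b_def)
  have "(LINT x|lborel. g x * \<psi> x) + (LINT x|lborel. f x * \<psi>' x) =
      (LINT x|lborel. g x * \<psi> x + f x * \<psi>' x)"
    by (rule Bochner_Integration.integral_add[symmetric])
      (rule locally_integrable_compact_support(1)[OF g cont s(1)]
        locally_integrable_compact_support(1)[OF lf \<psi>' s(2)]; assumption)+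
  also have "\<dots> = (LINT x:{-b..b}|lborel. g x * \<psi> x + f x * \<psi>' x)"
    unfolding set_lebesgue_integral_def
  proof (rule Bochner_Integration.integral_cong[OF refl])
    fix x
    show "g x * \<psi> x + f x * \<psi>' x = indicator {-b..b} x *\<^sub>R (g x * \<psi> x + f x * \<psi>' x)"
      using s[of x] by (cases "b < \<bar>x\<bar>") (auto simp: indicator_def abs_if split: if_splits)
  qed
  finally show ?thesis using 0 by simp
qed

section \<open>Test functions\<close>

lemma test_function_C_k: "\<phi> \<in> test_functions \<Omega> \<Longrightarrow> C_k k \<phi>"
  by (simp add: test_functions_def)

lemma test_function_continuous: "\<phi> \<in> test_functions \<Omega> \<Longrightarrow> continuous_on UNIV \<phi>"
  using test_function_C_k[of \<phi> \<Omega> 0] by simp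

lemma test_function_differentiable: "\<phi> \<in> test_functions \<Omega> \<Longrightarrow> \<phi> differentiable (at x)"
  using test_function_C_k[of \<phi> \<Omega> 1] by (simp add: differentiable_on_def)

lemma test_function_frechet:
  "\<phi> \<in> test_functions \<Omega> \<Longrightarrow> (\<phi> has_derivative (\<lambda>b. pderiv_dir b \<phi> x)) (at x)"
  unfolding pderiv_dir_def using frechet_derivative_works test_function_differentiable by blast

lemma test_function_support:
  fixes \<phi> :: "'a::euclidean_space \<Rightarrow> real"
  assumes "\<phi> \<in> test_functions \<Omega>"
  obtains a where "a > 0" "\<And>x. a < norm x \<Longrightarrow> \<phi> x = 0"
proof -
  have "bounded (closure {x. \<phi> x \<noteq> 0})"
    using assms compact_imp_bounded by (auto simp: test_functions_def)
  then obtain a where "a > 0" and a: "\<And>x. x \<in> closure {x. \<phi> x \<noteq> 0} \<Longrightarrow> norm x \<le> a"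
    by (auto simp: bounded_pos)
  then show ?thesis
    using that closure_subset[of "{x. \<phi> x \<noteq> 0}"] by force
qed

lemma test_function_pderiv:
  fixes \<phi> :: "'a::euclidean_space \<Rightarrow> real"
  assumes \<phi>: "\<phi> \<in> test_functions \<Omega>" and b: "b \<in> Basis"
  shows "pderiv_dir b \<phi> \<in> test_functions \<Omega>"
proof -
  define K where "K = closure {x. \<phi> x \<noteq> 0}"
  have K: "compact K" "K \<subseteq> \<Omega>"
    using \<phi> by (auto simp: test_functions_def K_def)
  have "pderiv_dir b \<phi> x = 0" if "x \<notin> K" for x
  proof -
    have "open (- K)" "x \<in> - K"
      using that by (auto simp: K_def)
    moreover have "0 = \<phi> y" if "y \<in> -K" for y
      using that closure_subset[of "{x. \<phi> x \<noteq> 0}"] by (auto simp: K_def)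
    ultimately have "(\<phi> has_derivative (\<lambda>_. 0)) (at x)"
      by (intro has_derivative_transform_within_open[OF has_derivative_const[where c = 0]])
    then show ?thesis
      using has_derivative_unique[OF test_function_frechet[OF \<phi>]] by metis
  qed
  then have "{x. pderiv_dir b \<phi> x \<noteq> 0} \<subseteq> K"
    by auto
  then have sub: "closure {x. pderiv_dir b \<phi> x \<noteq> 0} \<subseteq> K"
    by (simp add: K_def closure_minimal)
  then have "compact (closure {x. pderiv_dir b \<phi> x \<noteq> 0})"
    using K(1) by (metis closed_closure compact_Int_closed inf.absorb_iff2)
  then show ?thesis
    using sub K(2) b test_function_C_k[OF \<phi>, of "Suc _"] by (auto simp: test_functions_def)
qed

lemma test_function_deriv:
  fixes \<psi> :: "real \<Rightarrow> real"
  assumes "\<psi> \<in> test_functions \<Omega>"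
  shows "(\<psi> has_real_derivative deriv \<psi> x) (at x)" and "deriv \<psi> \<in> test_functions \<Omega>"
proof -
  have d: "(\<psi> has_real_derivative pderiv_dir 1 \<psi> x) (at x)" for x
  proof -
    have "linear (\<lambda>b. pderiv_dir b \<psi> x)"
      using test_function_frechet[OF assms] has_derivative_linear by blast
    then have "pderiv_dir b \<psi> x = pderiv_dir 1 \<psi> x * b" for b
      using linear_cmul[of "\<lambda>b. pderiv_dir b \<psi> x" b 1] by (simp add: mult.commute)
    then have "(\<lambda>b. pderiv_dir b \<psi> x) = (*) (pderiv_dir 1 \<psi> x)"
      by (intro ext)
    then show ?thesis
      using test_function_frechet[OF assms, of x] by (simp add: has_field_derivative_def)
  qed
  have "deriv \<psi> = pderiv_dir 1 \<psi>"
    using DERIV_imp_deriv[OF d] by blast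
  then show "(\<psi> has_real_derivative deriv \<psi> x) (at x)" "deriv \<psi> \<in> test_functions \<Omega>"
    using d test_function_pderiv[OF assms, of 1] by auto
qed

lemma test_function_bounds:
  assumes \<psi>: "\<psi> \<in> test_functions UNIV"
  obtains a where "\<And>x. a < \<bar>x\<bar> \<Longrightarrow> \<psi> x = 0" "\<And>x. a < \<bar>x\<bar> \<Longrightarrow> deriv \<psi> x = 0"
proof -
  obtain a where a: "\<And>x. a < norm x \<Longrightarrow> \<psi> x = 0"
    using \<psi> by (rule test_function_support) blast
  obtain b where b: "\<And>x. b < norm x \<Longrightarrow> deriv \<psi> x = 0"
    using test_function_deriv(2)[OF \<psi>] by (rule test_function_support) blast
  show ?thesis by (rule that[of "max a b"]) (use a b in auto)
qed

lemma test_function_dx: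
  assumes "\<phi> \<in> test_functions \<Omega>"
  shows "((\<lambda>x. \<phi> (t, x)) has_real_derivative dx \<phi> (t, x)) (at x)"
proof -
  have "linear (\<lambda>b. pderiv_dir b \<phi> (t, x))"
    using test_function_frechet[OF assms] has_derivative_linear by blast
  then have *: "pderiv_dir (0, b) \<phi> (t, x) = dx \<phi> (t, x) * b" for b
    using linear_cmul[of "\<lambda>b. pderiv_dir b \<phi> (t, x)" b "(0, 1)"] by (simp add: mult.commute)
  have "((\<lambda>x. (t, x)) has_derivative (\<lambda>b. (0, b))) (at x)"
    by (auto intro!: derivative_eq_intros)
  from has_derivative_compose[OF this test_function_frechet[OF assms]]
  show ?thesis unfolding has_field_derivative_def *[symmetric] .
qed

lemma test_function_dt:
  assumes "\<phi> \<in> test_functions \<Omega>"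
  shows "((\<lambda>t. \<phi> (t, x)) has_real_derivative dt \<phi> (t, x)) (at t)"
proof -
  have "linear (\<lambda>b. pderiv_dir b \<phi> (t, x))"
    using test_function_frechet[OF assms] has_derivative_linear by blast
  then have *: "pderiv_dir (b, 0) \<phi> (t, x) = dt \<phi> (t, x) * b" for b
    using linear_cmul[of "\<lambda>b. pderiv_dir b \<phi> (t, x)" b "(1, 0)"] by (simp add: mult.commute)
  have "((\<lambda>t. (t, x)) has_derivative (\<lambda>b. (b, 0))) (at t)"
    by (auto intro!: derivative_eq_intros)
  from has_derivative_compose[OF this test_function_frechet[OF assms]]
  show ?thesis unfolding has_field_derivative_def *[symmetric] .
qed

lemma Basis_real_prod [simp]: "(1::real, 0::real) \<in> Basis" "(0::real, 1::real) \<in> Basis"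
  by (auto simp: Basis_prod_def)

lemma test_function_support2:
  fixes \<phi> :: "real \<times> real \<Rightarrow> real"
  assumes "\<phi> \<in> test_functions \<Omega>"
  obtains a where "a > 0" "\<And>t x. a < \<bar>t\<bar> \<or> a < \<bar>x\<bar> \<Longrightarrow> \<phi> (t, x) = 0"
proof -
  obtain a where a: "a > 0" "\<And>p. a < norm p \<Longrightarrow> \<phi> p = 0"
    using assms by (rule test_function_support) blast
  have "\<phi> (t, x) = 0" if "a < \<bar>t\<bar> \<or> a < \<bar>x\<bar>" for t x
    using that norm_fst_le[of t x] norm_snd_le[of x t]
    by (intro a(2)) auto
  then show ?thesis using that a(1) by blast
qed

section \<open>Integration over the plane\<close>

lemma integral_deriv_compact_support:
  fixes \<psi> \<psi>' :: "real \<Rightarrow> real"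
  assumes "\<And>x. (\<psi> has_real_derivative \<psi>' x) (at x)" "continuous_on UNIV \<psi>'"
    and "\<And>x. a < \<bar>x\<bar> \<Longrightarrow> \<psi> x = 0" "\<And>x. a < \<bar>x\<bar> \<Longrightarrow> \<psi>' x = 0"
  shows "(LINT x|lborel. \<psi>' x) = 0" and "(LINT x:{0..}|lborel. \<psi>' x) = - \<psi> 0"
proof -
  show "(LINT x|lborel. \<psi>' x) = 0"
    using integral_by_parts_compact_support[of "{}" "\<lambda>_. 1" "\<lambda>_. 0" \<psi> \<psi>' a]
      assms locally_integrable_continuous[of "\<lambda>_. 0"] by simp
  have cont: "continuous_on UNIV \<psi>"
    using assms(1) DERIV_isCont continuous_at_imp_continuous_on by blast
  define b where "b = \<bar>a\<bar> + 1"
  have "(LINT x:{0..}|lborel. \<psi>' x) = (LINT x:{0..b}|lborel. \<psi>' x)"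
    unfolding set_lebesgue_integral_def
  proof (rule Bochner_Integration.integral_cong[OF refl])
    fix x
    show "indicator {0..} x *\<^sub>R \<psi>' x = indicator {0..b} x *\<^sub>R \<psi>' x"
      using assms(4)[of x] by (cases "x \<le> b") (auto simp: indicator_def b_def)
  qed
  also have "\<dots> = \<psi> b - \<psi> 0"
    by (rule FTC_finite_exceptions[where Z = "{}"])
      (use assms locally_integrableD[OF locally_integrable_continuous[OF assms(2)]] in
        \<open>auto simp: b_def intro: continuous_on_subset[OF cont]\<close>)
  also have "\<psi> b = 0"
    using assms(3)[of b] by (simp add: b_def)
  finally show "(LINT x:{0..}|lborel. \<psi>' x) = - \<psi> 0" by simp
qed

lemma continuous_on_slices:
  fixes \<rho> :: "real \<times> real \<Rightarrow> real"
  assumes "continuous_on UNIV \<rho>"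
  shows "continuous_on UNIV (\<lambda>x. \<rho> (t, x))" and "continuous_on UNIV (\<lambda>t. \<rho> (t, x))"
  by (rule continuous_on_compose2[OF assms]; auto intro!: continuous_intros)+

lemma integrable_indicator_Icc [simp]: "integrable lborel (indicat_real {a..b::real})"
  by (intro integrable_real_indicator) (auto simp: emeasure_lborel_Icc_eq)

text \<open>\<open>g\<close> may be unbounded, so the majorant is \<open>|g|\<close> on
  \<open>{-a..a}\<close> times a bound for the continuous factor \<open>\<rho>\<close>. The set
  \<open>T\<close> is the range of times: the line for weak solutions, the half-line for
  conservative ones.\<close>

lemma integrable_tensor:
  fixes \<rho> :: "real \<times> real \<Rightarrow> real"
  assumes g: "locally_integrable g" and \<rho>: "continuous_on UNIV \<rho>"
    and supp: "\<And>t x. a < \<bar>t\<bar> \<or> a < \<bar>x\<bar> \<Longrightarrow> \<rho> (t, x) = 0"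
    and T[measurable]: "T \<in> sets borel"
  shows "integrable lborel (\<lambda>(t, x). indicator T t * (g x * \<rho> (t, x)))"
proof -
  have [measurable]: "g \<in> borel_measurable borel" "\<rho> \<in> borel_measurable (borel \<Otimes>\<^sub>M borel)"
    using g \<rho> by (auto intro: borel_measurable_continuous_onI locally_integrable_measurable
        simp: borel_prod)
  have "compact (\<rho> ` ({-a..a} \<times> {-a..a}))"
    by (intro compact_continuous_image continuous_on_subset[OF \<rho>] compact_Times) auto
  then obtain M where M: "\<And>p. p \<in> {-a..a} \<times> {-a..a} \<Longrightarrow> \<bar>\<rho> p\<bar> \<le> M"
    by (metis bounded_iff compact_imp_bounded imageI real_norm_def)
  have bound: "\<bar>\<rho> (t, x)\<bar> \<le> \<bar>M\<bar> * (indicator {-a..a} t * indicator {-a..a} x)" for t x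
  proof (cases "a < \<bar>t\<bar> \<or> a < \<bar>x\<bar>")
    case False
    then have "t \<in> {-a..a}" "x \<in> {-a..a}" by auto
    then show ?thesis using M[of "(t, x)"] by auto
  qed (simp add: supp)
  have slice: "integrable lborel (\<lambda>x. indicator T t * (g x * \<rho> (t, x)))" for t
    by (intro integrable_mult_right locally_integrable_compact_support(1)[OF g, of _ a]
        continuous_on_slices[OF \<rho>] supp) auto
  have gint: "integrable lborel (\<lambda>x. indicator {-a..a} x * \<bar>g x\<bar>)"
    using integrable_norm[OF locally_integrableD[OF g, unfolded set_integrable_def, of "-a" a]]
    by (simp add: abs_mult)
  define N where "N = (LINT x|lborel. \<bar>M\<bar> * (indicator {-a..a} x * \<bar>g x\<bar>))"
  have "N \<ge> 0" unfolding N_def by (rule Bochner_Integration.integral_nonneg) auto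
  have inner: "(LINT x|lborel. norm (indicator T t * (g x * \<rho> (t, x)))) \<le> N * indicator {-a..a} t" for t
  proof -
    have "(LINT x|lborel. norm (indicator T t * (g x * \<rho> (t, x)))) \<le>
        (LINT x|lborel. indicator {-a..a} t * (\<bar>M\<bar> * (indicator {-a..a} x * \<bar>g x\<bar>)))"
    proof (rule integral_mono)
      fix x
      have "norm (indicator T t * (g x * \<rho> (t, x))) \<le> \<bar>g x\<bar> * \<bar>\<rho> (t, x)\<bar>"
        by (auto simp: indicator_def abs_mult)
      also have "\<dots> \<le> \<bar>g x\<bar> * (\<bar>M\<bar> * (indicator {-a..a} t * indicator {-a..a} x))"
        by (intro mult_left_mono bound) auto
      finally show "norm (indicator T t * (g x * \<rho> (t, x))) \<le>
          indicator {-a..a} t * (\<bar>M\<bar> * (indicator {-a..a} x * \<bar>g x\<bar>))"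
        by (simp add: mult_ac)
    qed (use slice gint in auto)
    then show ?thesis by (simp add: N_def mult.commute)
  qed
  have "integrable (lborel \<Otimes>\<^sub>M lborel) (\<lambda>(t, x). indicator T t * (g x * \<rho> (t, x)))"
  proof (rule lborel_pair.Fubini_integrable)
    show "integrable lborel
        (\<lambda>t. LINT x|lborel. norm (case (t, x) of (t, x) \<Rightarrow> indicator T t * (g x * \<rho> (t, x))))"
    proof (rule Bochner_Integration.integrable_bound)
      show "integrable lborel (\<lambda>t. N * indicator {-a..a} t)" by simp
      show "AE t in lborel.
          norm (LINT x|lborel. norm (case (t, x) of (t, x) \<Rightarrow> indicator T t * (g x * \<rho> (t, x))))
          \<le> norm (N * indicator {-a..a} t)"
        using inner \<open>N \<ge> 0\<close> by (auto intro!: AE_I2)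
    qed measurable
  qed (use slice in auto)
  then show ?thesis by (simp add: lborel_prod)
qed

text \<open>Both orders are needed: a time derivative of a test function is integrated in
  \<open>t\<close> with \<open>g x\<close> pulled out, whereas a space derivative has to meet
  \<open>g\<close> on a fixed time slice.\<close>

lemma integral_tensor:
  fixes \<rho> :: "real \<times> real \<Rightarrow> real"
  assumes g: "locally_integrable g" and \<rho>: "continuous_on UNIV \<rho>"
    and supp: "\<And>t x. a < \<bar>t\<bar> \<or> a < \<bar>x\<bar> \<Longrightarrow> \<rho> (t, x) = 0"
    and T: "T \<in> sets borel"
  shows "(LINT (t, x)|lborel. indicator T t * (g x * \<rho> (t, x))) =
      (LINT x|lborel. g x * (LINT t:T|lborel. \<rho> (t, x)))"
    and "(LINT (t, x)|lborel. indicator T t * (g x * \<rho> (t, x))) =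
      (LINT t:T|lborel. LINT x|lborel. g x * \<rho> (t, x))"
proof -
  have int: "integrable (lborel \<Otimes>\<^sub>M lborel) (\<lambda>(t, x). indicator T t * (g x * \<rho> (t, x)))"
    using integrable_tensor[OF assms] by (simp add: lborel_prod)
  show "(LINT (t, x)|lborel. indicator T t * (g x * \<rho> (t, x))) =
      (LINT x|lborel. g x * (LINT t:T|lborel. \<rho> (t, x)))"
    using lborel_pair.integral_snd[OF int]
    by (simp add: lborel_prod set_lebesgue_integral_def mult.left_commute[of "indicator _ _"])
  show "(LINT (t, x)|lborel. indicator T t * (g x * \<rho> (t, x))) =
      (LINT t:T|lborel. LINT x|lborel. g x * \<rho> (t, x))"
    using lborel_pair.integral_fst[OF int] by (simp add: lborel_prod set_lebesgue_integral_def)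
qed

lemma set_integrable_compact_snd:
  assumes g: "locally_integrable g" and K: "compact (K :: (real \<times> real) set)"
  shows "set_integrable lborel K (\<lambda>(t, x). g x)"
proof -
  have [measurable]: "g \<in> borel_measurable borel"
    using g by (rule locally_integrable_measurable)
  obtain a where a: "a > 0" "\<And>p. p \<in> K \<Longrightarrow> norm p \<le> a"
    using compact_imp_bounded[OF K] by (auto simp: bounded_pos)
  have sub: "K \<subseteq> {-a..a} \<times> {-a..a}"
  proof
    fix p assume "p \<in> K"
    then show "p \<in> {-a..a} \<times> {-a..a}"
      using a(2)[of p] norm_fst_le[of "fst p" "snd p"] norm_snd_le[of "snd p" "fst p"]
      by (cases p) (auto simp: abs_le_iff)
  qed
  have gint: "integrable lborel (\<lambda>x. indicator {-a..a} x * \<bar>g x\<bar>)"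
    using integrable_norm[OF locally_integrableD[OF g, unfolded set_integrable_def, of "-a" a]]
    by (simp add: abs_mult)
  have "integrable (lborel \<Otimes>\<^sub>M lborel) (\<lambda>(t, x). indicator {-a..a} t * (indicator {-a..a} x * g x))"
  proof (rule lborel_pair.Fubini_integrable)
    have "(LINT x|lborel. norm (indicator {-a..a} t * (indicator {-a..a} x * g x))) =
        (LINT x|lborel. indicator {-a..a} x * \<bar>g x\<bar>) * indicator {-a..a} t" for t
      by (simp add: abs_mult)
    then show "integrable lborel (\<lambda>t. LINT x|lborel.
        norm (case (t, x) of (t, x) \<Rightarrow> indicator {-a..a} t * (indicator {-a..a} x * g x)))"
      by (simp del: real_norm_def)
  qed (use locally_integrableD[OF g, unfolded set_integrable_def] in auto)
  then have "set_integrable lborel ({-a..a} \<times> {-a..a}) (\<lambda>(t, x). g x)"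
    by (simp add: lborel_prod set_integrable_def indicator_times case_prod_unfold mult.assoc)
  then show ?thesis
    by (rule set_integrable_subset) (use K sub in \<open>auto intro: borel_compact\<close>)
qed

text \<open>The derivative in \<open>t\<close> is the inner one, so the fundamental theorem does not
  apply in \<open>t\<close> directly. Differentiation under the integral sign takes the place of the
  symmetry of mixed derivatives: the integral of \<open>dt \<phi>\<close> over \<open>t\<close> is
  zero for each \<open>x\<close>, hence so is its derivative in \<open>x\<close>.\<close>

lemma integral_dx_dt_test_function:
  assumes \<phi>: "\<phi> \<in> test_functions UNIV"
  shows "(LINT t|lborel. dx (dt \<phi>) (t, x)) = 0"
proof -
  have dt\<phi>: "dt \<phi> \<in> test_functions UNIV" and dxdt: "dx (dt \<phi>) \<in> test_functions UNIV"
    using \<phi> by (simp_all add: test_function_pderiv)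
  obtain a1 where a1: "\<And>t x. a1 < \<bar>t\<bar> \<or> a1 < \<bar>x\<bar> \<Longrightarrow> \<phi> (t, x) = 0"
    using test_function_support2[OF \<phi>] by metis
  obtain a2 where a2: "\<And>t x. a2 < \<bar>t\<bar> \<or> a2 < \<bar>x\<bar> \<Longrightarrow> dt \<phi> (t, x) = 0"
    using test_function_support2[OF dt\<phi>] by metis
  obtain a3 where a3: "\<And>t x. a3 < \<bar>t\<bar> \<or> a3 < \<bar>x\<bar> \<Longrightarrow> dx (dt \<phi>) (t, x) = 0"
    using test_function_support2[OF dxdt] by metis
  \<comment> \<open>A common bound for the supports turns the Lebesgue integrals into integrals over
    one compact interval, as the Leibniz rule requires.\<close>
  define a where "a = max a1 (max a2 a3)"
  have eq: "(LINT t|lborel. h t) = integral (cbox (-a) a) h"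
    if "continuous_on UNIV h" "\<And>t. a < \<bar>t\<bar> \<Longrightarrow> h t = 0" for h :: "real \<Rightarrow> real"
    using locally_integrable_compact_support(2)[of "\<lambda>_. 1" h a] that
      set_borel_integral_eq_integral(2)[OF locally_integrableD[OF locally_integrable_continuous[OF that(1)]]]
      locally_integrable_continuous[of "\<lambda>_. 1"]
    by simp
  have zero: "integral (cbox (-a) a) (\<lambda>t. dt \<phi> (t, y)) = 0" for y
  proof -
    have c: "continuous_on UNIV (\<lambda>t. dt \<phi> (t, y))"
      by (rule continuous_on_slices[OF test_function_continuous[OF dt\<phi>]])
    have "(LINT t|lborel. dt \<phi> (t, y)) = 0"
      by (rule integral_deriv_compact_support(1)[where a = a, OF test_function_dt[OF \<phi>] c])
        (auto simp: a_def a1 a2)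
    then show ?thesis
      using eq[OF c] a2 by (simp add: a_def)
  qed
  have "((\<lambda>y. integral (cbox (-a) a) (\<lambda>t. dt \<phi> (t, y))) has_real_derivative
      integral (cbox (-a) a) (\<lambda>t. dx (dt \<phi>) (t, x))) (at x within UNIV)"
  proof (rule leibniz_rule_field_derivative)
    show "((\<lambda>x. dt \<phi> (t, x)) has_real_derivative dx (dt \<phi>) (t, x)) (at x within UNIV)" for x t
      using test_function_dx[OF dt\<phi>] by simp
    show "(\<lambda>t. dt \<phi> (t, x)) integrable_on cbox (-a) a" for x
      by (intro integrable_continuous continuous_on_subset[OF
            continuous_on_slices(2)[OF test_function_continuous[OF dt\<phi>]]]) auto
    show "continuous_on (UNIV \<times> cbox (-a) a) (\<lambda>(x, t). dx (dt \<phi>) (t, x))"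
      unfolding case_prod_beta
      by (rule continuous_on_compose2[OF test_function_continuous[OF dxdt]])
        (auto intro!: continuous_intros)
  qed auto
  then have "integral (cbox (-a) a) (\<lambda>t. dx (dt \<phi>) (t, x)) = 0"
    unfolding zero using DERIV_unique[OF DERIV_const] by fastforce
  then show ?thesis
    using eq[OF continuous_on_slices(2)[OF test_function_continuous[OF dxdt]], of x] a3
    by (simp add: a_def)
qed

section \<open>Stationary solutions with isolated singularities\<close>

text \<open>Here \<open>m\<close> is \<open>u u\<^sub>x\<close>, the quantity that stays continuous at the points of \<open>Z\<close>, where
  \<open>u = 0\<close> (cusps) or \<open>u\<^sub>x = 0\<close> (crests, where the equation for \<open>m'\<close> need not be
  assumed). At a cusp \<open>u\<^sub>x = m / u\<close> takes the value \<open>0 / 0 = 0\<close>.\<close>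

locale stationary =
  fixes l F S B :: real and u m :: "real \<Rightarrow> real" and Z :: "real set"
  assumes l: "l > 0"
    and finite_Z: "finite (Z \<inter> {a..b})"
    and u_cont: "continuous_on UNIV u" and m_cont: "continuous_on UNIV m"
    and u_bound: "\<bar>u x\<bar> \<le> B" and m_bound: "\<bar>m x\<bar> \<le> B"
    and u_nz: "x \<notin> Z \<Longrightarrow> u x \<noteq> 0"
    and m_sq: "l\<^sup>2 * (m x)\<^sup>2 = u x * (2 * F - 2 * S * u x + (u x)^3 / 3)"
    and u_deriv: "x \<notin> Z \<Longrightarrow> (u has_real_derivative m x / u x) (at x)"
    and m_deriv: "x \<notin> Z \<Longrightarrow>
      (m has_real_derivative (F / u x - 2 * S + 2 * (u x)\<^sup>2 / 3) / l\<^sup>2) (at x)"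
begin

definition w :: "real \<Rightarrow> real" where
  "w x = m x / u x"

definition p :: "real \<Rightarrow> real" where
  "p x = (S - (u x)\<^sup>2 / 2) / l\<^sup>2"

lemma u_measurable [measurable]: "u \<in> borel_measurable borel"
  using u_cont by (rule borel_measurable_continuous_onI)

lemma w_measurable [measurable]: "w \<in> borel_measurable borel"
  using borel_measurable_continuous_onI[OF m_cont] unfolding w_def by measurable

lemma p_cont: "continuous_on UNIV p"
  unfolding p_def using l by (intro continuous_intros u_cont) auto

lemma AE_not_Z: "AE x in lborel. x \<notin> Z"
proof -
  have "Z = (\<Union>n::nat. Z \<inter> {-real n..real n})"
  proof -
    have "\<exists>n::nat. x \<in> {-real n..real n}" for x :: real
      using real_arch_simple[of "\<bar>x\<bar>"] by (auto simp: abs_le_iff) (metis minus_le_iff)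
    then show ?thesis by blast
  qed
  then have "countable Z"
    using countable_UN[of "UNIV :: nat set" "\<lambda>n. Z \<inter> {-real n..real n}"] finite_Z
    by (simp add: countable_finite)
  then have "Z \<in> null_sets lborel"
    by (rule countable_imp_null_set_lborel)
  then show ?thesis by (rule AE_not_in)
qed

text \<open>This includes the zeros of \<open>u\<close>: there \<open>m_sq\<close> forces
  \<open>m x = 0\<close>.\<close>

lemma u_w [simp]: "u x * w x = m x"
  using m_sq[of x] l by (cases "u x = 0") (auto simp: w_def)

lemma w_sq: "x \<notin> Z \<Longrightarrow> l\<^sup>2 * u x * (w x)\<^sup>2 = 2 * F - 2 * S * u x + (u x)^3 / 3"
  using u_nz[of x] m_sq[of x] by (auto simp: w_def power2_eq_square field_simps)

text \<open>Eliminating \<open>F\<close> by means of \<open>w_sq\<close> leaves a square minus a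
  continuous function. The integrability of \<open>w^2\<close> rests on this sign of the unbounded
  part.\<close>

lemma m_deriv': "x \<notin> Z \<Longrightarrow> (m has_real_derivative (w x)\<^sup>2 / 2 - p x) (at x)"
proof -
  assume x: "x \<notin> Z"
  have "l\<^sup>2 * (w x)\<^sup>2 = (2 * F - 2 * S * u x + (u x)^3 / 3) / u x"
    using w_sq[OF x] u_nz[OF x] by (simp add: field_simps)
  moreover have "l\<^sup>2 * p x = S - (u x)\<^sup>2 / 2"
    using l by (simp add: p_def)
  ultimately have "l\<^sup>2 * ((w x)\<^sup>2 / 2 - p x) = (2 * F - 2 * S * u x + (u x)^3 / 3) / u x / 2 - (S - (u x)\<^sup>2 / 2)"
    by (simp add: right_diff_distrib)
  also have "\<dots> = F / u x - 2 * S + 2 * (u x)\<^sup>2 / 3"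
    using u_nz[OF x] by (simp add: field_simps power2_eq_square power3_eq_cube)
  finally have "l\<^sup>2 * ((w x)\<^sup>2 / 2 - p x) = F / u x - 2 * S + 2 * (u x)\<^sup>2 / 3" .
  then have "(F / u x - 2 * S + 2 * (u x)\<^sup>2 / 3) / l\<^sup>2 = (w x)\<^sup>2 / 2 - p x"
    using l by (simp add: field_simps)
  then show ?thesis using m_deriv[OF x] by simp
qed

lemma w_sq_integrable: "locally_integrable (\<lambda>x. (w x)\<^sup>2)"
  unfolding locally_integrable_def
proof (intro conjI allI)
  fix a b :: real
  \<comment> \<open>Twice the derivative of \<open>m\<close> is \<open>w^2 - 2 p\<close>; adding the
    primitive of \<open>p\<close> makes \<open>G\<close> a continuous primitive of
    \<open>w^2\<close> off \<open>Z\<close>.\<close>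
  define G where "G x = 2 * (m x + integral {a..x} p)" for x
  show "set_integrable lborel {a..b} (\<lambda>x. (w x)\<^sup>2)"
  proof (cases "a \<le> b")
    case True
    have pc: "continuous_on {a..b} p" using p_cont continuous_on_subset by blast
    show ?thesis
    proof (rule FTC_nonneg_integrable[OF True finite_Z, where f = G])
      show "continuous_on {a..b} G"
        unfolding G_def
        by (intro continuous_intros continuous_on_subset[OF m_cont] indefinite_integral_continuous_1
            integrable_continuous_real pc) auto
      show "(G has_real_derivative (w x)\<^sup>2) (at x)" if x: "x \<in> {a<..<b} - Z" for x
      proof -
        have "((\<lambda>x. integral {a..x} p) has_real_derivative p x) (at x within {a..b})"
          using integral_has_real_derivative[OF pc] x by auto
        then have "((\<lambda>x. integral {a..x} p) has_real_derivative p x) (at x)"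
          using x by (simp add: at_within_Icc_at)
        then show ?thesis
          unfolding G_def using x by (auto intro!: derivative_eq_intros m_deriv')
      qed
    qed auto
  qed (simp add: set_integrable_def)
qed measurable

lemma w_integrable: "locally_integrable w"
proof (rule locally_integrable_bound)
  show "locally_integrable (\<lambda>x. 1 + (w x)\<^sup>2)"
    by (intro locally_integrable_add w_sq_integrable locally_integrable_continuous) auto
  show "\<bar>w x\<bar> \<le> \<bar>1 + (w x)\<^sup>2\<bar>" for x
    using zero_le_power2[of "\<bar>w x\<bar> - 1"] by (auto simp: power2_eq_square algebra_simps)
qed measurable

lemma weak_deriv_u: "weak_deriv u w"
  unfolding weak_deriv_def
proof (intro conjI ballI)
  have "locally_integrable (\<lambda>x. (u x)\<^sup>2)"
    by (intro locally_integrable_continuous continuous_intros u_cont)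
  then show "L2_loc u"
    by (auto simp: L2_loc_def locally_integrable_def)
  show "L2_loc w"
    using w_sq_integrable by (auto simp: L2_loc_def locally_integrable_def)
  fix \<psi> :: "real \<Rightarrow> real" assume \<psi>: "\<psi> \<in> test_functions UNIV"
  obtain a where a: "\<And>x. a < \<bar>x\<bar> \<Longrightarrow> \<psi> x = 0" "\<And>x. a < \<bar>x\<bar> \<Longrightarrow> deriv \<psi> x = 0"
    using \<psi> by (rule test_function_bounds) blast
  show "(LINT x|lborel. u x * deriv \<psi> x) = - (LINT x|lborel. w x * \<psi> x)"
    by (rule integral_by_parts_compact_support[where Z = Z and a = a])
      (use finite_Z u_cont u_deriv w_integrable test_function_deriv[OF \<psi>] a
       in \<open>auto simp: w_def[symmetric] intro: test_function_continuous\<close>)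
qed

lemma locally_integrable_energy:
  "locally_integrable (\<lambda>x. (u x)\<^sup>2 / 2 + l\<^sup>2 * (w x)\<^sup>2 / 2)"
  using locally_integrable_add[OF
      locally_integrable_continuous[of "\<lambda>x. (u x)\<^sup>2 / 2"]
      locally_integrable_mult_continuous[OF w_sq_integrable, of "\<lambda>_. l\<^sup>2 / 2"]]
  by (simp add: continuous_intros u_cont)

text \<open>Formulated for any suitable pair \<open>\<psi>\<close>, \<open>\<psi>'\<close> because
  it has two uses: test functions on the line and, on a fixed time slice, \<open>dx \<phi>\<close>
  with its own derivative in \<open>x\<close>.\<close>

lemma momentum_identity:
  assumes \<psi>: "\<And>x. (\<psi> has_real_derivative \<psi>' x) (at x)" and \<psi>': "continuous_on UNIV \<psi>'"
    and supp: "\<And>x. a < \<bar>x\<bar> \<Longrightarrow> \<psi> x = 0" "\<And>x. a < \<bar>x\<bar> \<Longrightarrow> \<psi>' x = 0"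
  shows "(LINT x|lborel. ((u x)\<^sup>2 / 2 + l\<^sup>2 * (w x)\<^sup>2 / 2) * \<psi> x + l\<^sup>2 * u x * w x * \<psi>' x) =
    (LINT x|lborel. S * \<psi> x)"
proof -
  have cont: "continuous_on UNIV \<psi>"
    using \<psi> DERIV_isCont continuous_at_imp_continuous_on by blast
  have lm': "locally_integrable (\<lambda>x. (w x)\<^sup>2 / 2 - p x)"
    using locally_integrable_add[OF locally_integrable_mult_continuous[OF w_sq_integrable, of "\<lambda>_. 1/2"]
        locally_integrable_continuous[of "\<lambda>x. - p x"]] p_cont
    by (auto intro: continuous_intros)
  have i1: "integrable lborel (\<lambda>x. ((w x)\<^sup>2 / 2 - p x) * \<psi> x)"
    by (rule locally_integrable_compact_support(1)[OF lm' cont supp(1)])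
  have i2: "integrable lborel (\<lambda>x. ((u x)\<^sup>2 / 2 + l\<^sup>2 * (w x)\<^sup>2 / 2) * \<psi> x)"
    by (rule locally_integrable_compact_support(1)[OF locally_integrable_energy cont supp(1)])
  have i3: "integrable lborel (\<lambda>x. m x * \<psi>' x)"
    by (rule locally_integrable_compact_support(1)[OF locally_integrable_continuous[OF m_cont] \<psi>' supp(2)])
  have parts: "(LINT x|lborel. m x * \<psi>' x) = - (LINT x|lborel. ((w x)\<^sup>2 / 2 - p x) * \<psi> x)"
    by (rule integral_by_parts_compact_support[OF finite_Z m_cont m_deriv' lm' \<psi> \<psi>' supp])
  have "(LINT x|lborel. ((u x)\<^sup>2 / 2 + l\<^sup>2 * (w x)\<^sup>2 / 2) * \<psi> x + l\<^sup>2 * u x * w x * \<psi>' x) =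
      (LINT x|lborel. ((u x)\<^sup>2 / 2 + l\<^sup>2 * (w x)\<^sup>2 / 2) * \<psi> x + l\<^sup>2 * (m x * \<psi>' x))"
    by (simp only: mult.assoc[symmetric] u_w[symmetric])
  also have "\<dots> = (LINT x|lborel. ((u x)\<^sup>2 / 2 + l\<^sup>2 * (w x)\<^sup>2 / 2) * \<psi> x)
      - l\<^sup>2 * (LINT x|lborel. ((w x)\<^sup>2 / 2 - p x) * \<psi> x)"
    using i2 i3 by (simp add: parts)
  also have "\<dots> = (LINT x|lborel. ((u x)\<^sup>2 / 2 + l\<^sup>2 * (w x)\<^sup>2 / 2) * \<psi> x
      - l\<^sup>2 * (((w x)\<^sup>2 / 2 - p x) * \<psi> x))"
    using i1 i2 by simp
  \<comment> \<open>Here \<open>w^2\<close> cancels identically, so the integrands agree at every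
    point, cusps included.\<close>
  also have "\<dots> = (LINT x|lborel. S * \<psi> x)"
    using l by (intro Bochner_Integration.integral_cong) (auto simp: p_def field_simps)
  finally show ?thesis .
qed

lemma energy_identity:
  assumes \<psi>: "\<And>x. (\<psi> has_real_derivative \<psi>' x) (at x)" and \<psi>': "continuous_on UNIV \<psi>'"
    and supp: "\<And>x. a < \<bar>x\<bar> \<Longrightarrow> \<psi> x = 0" "\<And>x. a < \<bar>x\<bar> \<Longrightarrow> \<psi>' x = 0"
  shows "(LINT x|lborel. ((u x)^3 / 3 + 2 * l\<^sup>2 * u x * (w x)\<^sup>2) * \<psi> x
      + l\<^sup>2 * (u x)\<^sup>2 * w x * \<psi>' x) = (LINT x|lborel. F * \<psi> x)"
proof -
  have cont: "continuous_on UNIV \<psi>"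
    using \<psi> DERIV_isCont continuous_at_imp_continuous_on by blast
  have luw: "locally_integrable (\<lambda>x. u x * (w x)\<^sup>2)"
    by (rule locally_integrable_mult_continuous[OF w_sq_integrable u_cont])
  have lm': "locally_integrable (\<lambda>x. 3 / 2 * (u x * (w x)\<^sup>2) + - (u x * p x))"
    by (intro locally_integrable_add locally_integrable_mult_continuous[OF luw]
        locally_integrable_continuous continuous_intros u_cont p_cont)
  have lum: "locally_integrable (\<lambda>x. (u x)^3 / 3 + 2 * l\<^sup>2 * (u x * (w x)\<^sup>2))"
    by (intro locally_integrable_add locally_integrable_mult_continuous[OF luw]
        locally_integrable_continuous continuous_intros u_cont p_cont) auto
  have umc: "continuous_on UNIV (\<lambda>x. u x * m x)"
    by (intro continuous_intros u_cont m_cont)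
  \<comment> \<open>In the product rule \<open>u_x m = u w^2\<close> contributes 1 and
    \<open>u m' = u (w^2 / 2 - p)\<close> contributes 1/2 to the coefficient 3/2.\<close>
  have d: "((\<lambda>x. u x * m x) has_real_derivative 3 / 2 * (u x * (w x)\<^sup>2) + - (u x * p x)) (at x)"
    if "x \<notin> Z" for x
    by (rule DERIV_cong[OF DERIV_mult[OF u_deriv[OF that] m_deriv'[OF that]]])
      (simp add: w_def[symmetric] u_w[symmetric] power2_eq_square algebra_simps del: u_w)
  have i1: "integrable lborel (\<lambda>x. (3 / 2 * (u x * (w x)\<^sup>2) + - (u x * p x)) * \<psi> x)"
    by (rule locally_integrable_compact_support(1)[OF lm' cont supp(1)])
  have i2: "integrable lborel (\<lambda>x. ((u x)^3 / 3 + 2 * l\<^sup>2 * (u x * (w x)\<^sup>2)) * \<psi> x)"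
    by (rule locally_integrable_compact_support(1)[OF lum cont supp(1)])
  have i3: "integrable lborel (\<lambda>x. u x * m x * \<psi>' x)"
    by (rule locally_integrable_compact_support(1)[OF locally_integrable_continuous[OF umc] \<psi>' supp(2)])
  have parts: "(LINT x|lborel. u x * m x * \<psi>' x) =
      - (LINT x|lborel. (3 / 2 * (u x * (w x)\<^sup>2) + - (u x * p x)) * \<psi> x)"
    by (rule integral_by_parts_compact_support[OF finite_Z umc d lm' \<psi> \<psi>' supp])
  have "(LINT x|lborel. ((u x)^3 / 3 + 2 * l\<^sup>2 * u x * (w x)\<^sup>2) * \<psi> x + l\<^sup>2 * (u x)\<^sup>2 * w x * \<psi>' x) =
      (LINT x|lborel. ((u x)^3 / 3 + 2 * l\<^sup>2 * (u x * (w x)\<^sup>2)) * \<psi> x + l\<^sup>2 * (u x * m x * \<psi>' x))"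
    by (simp only: mult.assoc u_w[symmetric] power2_eq_square)
  also have "\<dots> = (LINT x|lborel. ((u x)^3 / 3 + 2 * l\<^sup>2 * (u x * (w x)\<^sup>2)) * \<psi> x)
      - l\<^sup>2 * (LINT x|lborel. (3 / 2 * (u x * (w x)\<^sup>2) + - (u x * p x)) * \<psi> x)"
    using Bochner_Integration.integral_add[OF i2 integrable_mult_right[OF i3, of "l\<^sup>2"]]
    by (simp only: parts Bochner_Integration.integral_mult_right_zero)
  also have "\<dots> = (LINT x|lborel. ((u x)^3 / 3 + 2 * l\<^sup>2 * (u x * (w x)\<^sup>2)) * \<psi> x
      - l\<^sup>2 * ((3 / 2 * (u x * (w x)\<^sup>2) + - (u x * p x)) * \<psi> x))"
    using Bochner_Integration.integral_diff[OF i2 integrable_mult_right[OF i1, of "l\<^sup>2"]]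
    by (simp only: Bochner_Integration.integral_mult_right_zero)
  \<comment> \<open>Unlike in the momentum identity, a multiple of \<open>u w^2\<close> remains and
    has to be replaced through \<open>w_sq\<close>. At a zero of \<open>u\<close> that equation
    would read \<open>0 = 2 * F\<close>, hence equality almost everywhere only.\<close>
  also have "\<dots> = (LINT x|lborel. F * \<psi> x)"
  proof (rule integral_cong_AE)
    have [measurable]: "\<psi> \<in> borel_measurable borel"
      using cont by (rule borel_measurable_continuous_onI)
    have [measurable]: "p \<in> borel_measurable borel"
      using p_cont by (rule borel_measurable_continuous_onI)
    show "(\<lambda>x. ((u x)^3 / 3 + 2 * l\<^sup>2 * (u x * (w x)\<^sup>2)) * \<psi> x
      - l\<^sup>2 * ((3 / 2 * (u x * (w x)\<^sup>2) + - (u x * p x)) * \<psi> x)) \<in> borel_measurable lborel"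
      "(\<lambda>x. F * \<psi> x) \<in> borel_measurable lborel" by measurable
    have id: "(u x)^3 / 3 + 2 * l\<^sup>2 * (u x * (w x)\<^sup>2) - l\<^sup>2 * (3 / 2 * (u x * (w x)\<^sup>2) + - (u x * p x)) = F"
      if "x \<notin> Z" for x
    proof -
      have "l\<^sup>2 * (u x * p x) = u x * (S - (u x)\<^sup>2 / 2)"
        using l by (simp add: p_def)
      then show ?thesis
        using w_sq[OF that]
        by (simp add: algebra_simps power2_eq_square power3_eq_cube del: u_w)
    qed
    show "AE x in lborel. ((u x)^3 / 3 + 2 * l\<^sup>2 * (u x * (w x)\<^sup>2)) * \<psi> x
      - l\<^sup>2 * ((3 / 2 * (u x * (w x)\<^sup>2) + - (u x * p x)) * \<psi> x) = F * \<psi> x"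
      using AE_not_Z
    proof eventually_elim
      case (elim x)
      show ?case
        using arg_cong[OF id[OF elim], of "\<lambda>y. y * \<psi> x"] by (simp only: left_diff_distrib mult.assoc)
    qed
  qed
  finally show ?thesis .
qed

end

section \<open>Integrals over half-lines and the convolution with the kernel\<close>

lemma has_bochner_integral_FTC_atLeast:
  fixes f G :: "real \<Rightarrow> real"
  assumes Z: "\<And>a b. finite (Z \<inter> {a..b})" and G: "continuous_on UNIV G"
    and G': "\<And>x. x \<notin> Z \<Longrightarrow> (G has_real_derivative - f x) (at x)"
    and f[measurable]: "f \<in> borel_measurable borel" and nonneg: "\<And>x. 0 \<le> f x"
    and lim: "(G \<longlongrightarrow> 0) at_top"
  shows "has_bochner_integral lborel (\<lambda>y. indicator {x..} y * f y) (G x)"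
proof (rule has_bochner_integral_monotone_convergence_at_top)
  have d: "((\<lambda>x. - G x) has_real_derivative f x) (at x)" if "x \<notin> Z" for x
    using DERIV_minus[OF G'[OF that]] by simp
  have c: "continuous_on A (\<lambda>x. - G x)" for A
    by (intro continuous_intros continuous_on_subset[OF G]) auto
  have si: "set_integrable lborel {x..y} f" if "x \<le> y" for y
    by (rule FTC_nonneg_integrable[OF that Z c d f nonneg]) auto
  have eq: "indicator {x..} z * f z * indicator {..y} z = indicator {x..y} z *\<^sub>R f z" for y z
    by (auto simp: indicator_def)
  show "integrable lborel (\<lambda>z. indicator {x..} z * f z * indicator {..y} z)" for y
    unfolding eq using si[of y] by (cases "x \<le> y") (auto simp: set_integrable_def)
  have "((\<lambda>y. G x - G y) \<longlongrightarrow> G x - 0) at_top"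
    by (intro tendsto_intros lim)
  moreover have "\<forall>\<^sub>F y in at_top.
      G x - G y = (LINT z|lborel. indicator {x..} z * f z * indicator {..y} z)"
    using eventually_ge_at_top[of x]
  proof eventually_elim
    case (elim y)
    have "(LINT z:{x..y}|lborel. f z) = - G y - - G x"
      by (rule FTC_finite_exceptions[OF elim Z c d si[OF elim]]) auto
    then show ?case by (simp add: eq set_lebesgue_integral_def)
  qed
  ultimately show "((\<lambda>y. LINT z|lborel. indicator {x..} z * f z * indicator {..y} z) \<longlongrightarrow> G x) at_top"
    by (simp add: tendsto_cong)
qed (use nonneg in auto)

lemma has_bochner_integral_FTC_atMost:
  fixes f G :: "real \<Rightarrow> real"
  assumes Z: "\<And>a b. finite (Z \<inter> {a..b})" and G: "continuous_on UNIV G"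
    and G': "\<And>x. x \<notin> Z \<Longrightarrow> (G has_real_derivative f x) (at x)"
    and f[measurable]: "f \<in> borel_measurable borel" and nonneg: "\<And>x. 0 \<le> f x"
    and lim: "(G \<longlongrightarrow> 0) at_bot"
  shows "has_bochner_integral lborel (\<lambda>y. indicator {..x} y * f y) (G x)"
proof -
  \<comment> \<open>Reflection in the origin reduces the claim to the other half-line.\<close>
  have "has_bochner_integral lborel (\<lambda>y. indicator {-x..} y * f (-y)) (G (- (-x)))"
  proof (rule has_bochner_integral_FTC_atLeast)
    show "finite (uminus ` Z \<inter> {a..b})" for a b
    proof -
      have "uminus ` Z \<inter> {a..b} = uminus ` (Z \<inter> {-b..-a})" by force
      then show ?thesis using Z by simp
    qed
    show "continuous_on UNIV (\<lambda>y. G (-y))"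
      by (intro continuous_on_compose2[OF G] continuous_intros) auto
    show "((\<lambda>y. G (-y)) has_real_derivative - f (-y)) (at y)" if "y \<notin> uminus ` Z" for y
    proof -
      have "-y \<notin> Z" using that by (metis imageI minus_minus)
      then show ?thesis
        by (auto intro!: DERIV_cong[OF DERIV_chain2[OF G']] derivative_eq_intros)
    qed
    show "((\<lambda>y. G (-y)) \<longlongrightarrow> 0) at_top"
      using filterlim_compose[OF lim filterlim_uminus_at_bot_at_top] .
  qed (use nonneg in auto)
  then have "has_bochner_integral lborel (\<lambda>y. indicator {-x..} (0 + -1 * y) * f (-(0 + -1 * y)))
      (G (- (-x)) /\<^sub>R \<bar>-1\<bar>)"
    by (subst lborel_has_bochner_integral_real_affine_iff[symmetric]) auto
  then show ?thesis
    by (simp add: indicator_def)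
qed

context stationary
begin

text \<open>No uniqueness theorem for the differential equation is invoked: the two halves of the
  kernel are integrated in closed form. This also yields the existence of the convolution at every
  point, which \<open>P_defined\<close> demands.\<close>

lemma has_bochner_integral_kernel:
  "has_bochner_integral lborel (\<lambda>y. kernel l (x - y) * ((w y)\<^sup>2 / 2)) (p x)"
proof -
  have p_deriv: "(p has_real_derivative - m y / l\<^sup>2) (at y)" if "y \<notin> Z" for y
  proof -
    have "((\<lambda>x. (u x)\<^sup>2) has_real_derivative 2 * m y) (at y)"
      using u_nz[OF that] by (auto intro!: derivative_eq_intros u_deriv that)
    then show ?thesis
      unfolding p_def
      by (intro DERIV_cong[OF DERIV_cdivide[OF DERIV_diff[OF DERIV_const DERIV_cdivide]]]) auto
  qed
  obtain C where C: "\<And>y. \<bar>p y\<bar> \<le> C"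
  proof
    fix y
    have "(u y)\<^sup>2 \<le> B\<^sup>2"
      using u_bound[of y] by (metis abs_ge_zero order_trans power2_abs power_mono)
    then have "\<bar>S - (u y)\<^sup>2 / 2\<bar> \<le> \<bar>S\<bar> + B\<^sup>2 / 2"
      by (smt (verit) field_sum_of_halves zero_le_power2)
    then show "\<bar>p y\<bar> \<le> (\<bar>S\<bar> + B\<^sup>2 / 2) / l\<^sup>2"
      using l by (simp add: p_def divide_right_mono)
  qed
  have bound: "\<bar>l * p y - m y\<bar> \<le> l * C + B" "\<bar>l * p y + m y\<bar> \<le> l * C + B" for y
  proof -
    have "\<bar>l * p y\<bar> \<le> l * C"
      using l C[of y] by (simp add: abs_mult)
    then show "\<bar>l * p y - m y\<bar> \<le> l * C + B" "\<bar>l * p y + m y\<bar> \<le> l * C + B"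
      using m_bound[of y] by linarith+
  qed
  \<comment> \<open>Found from the factorisation \<open>1 - l^2 D^2 = (1 - l D) (1 + l D)\<close>
    and \<open>l^2 p' = - m\<close>: in the derivatives the terms in \<open>p\<close> and
    \<open>m\<close> cancel and leave the weighted \<open>w^2 / 2\<close>. Both functions decay in
    the relevant direction because \<open>p\<close> and \<open>m\<close> are bounded, and
    \<open>R x + L x = 2 * l * p x\<close>.\<close>
  define R where "R y = exp (- (y - x) / l) * (l * p y - m y)" for y
  define L where "L y = exp ((y - x) / l) * (l * p y + m y)" for y
  have right: "has_bochner_integral lborel (\<lambda>y. indicator {x..} y * (exp (- (y - x) / l) * ((w y)\<^sup>2 / 2))) (R x)"
  proof (rule has_bochner_integral_FTC_atLeast[OF finite_Z])
    show "continuous_on UNIV R"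
      unfolding R_def using l by (intro continuous_intros p_cont m_cont) auto
    show "(R has_real_derivative - (exp (- (y - x) / l) * ((w y)\<^sup>2 / 2))) (at y)" if "y \<notin> Z" for y
      unfolding R_def using l
      by (auto intro!: derivative_eq_intros m_deriv' p_deriv that)
        (simp add: field_simps power2_eq_square)
    have "((\<lambda>y. exp (- (y - x) / l) * (l * C + B)) \<longlongrightarrow> 0 * (l * C + B)) at_top"
      using l by (intro tendsto_intros) real_asymp
    then have "((\<lambda>y. exp (- (y - x) / l) * (l * C + B)) \<longlongrightarrow> 0) at_top" by simp
    then show "(R \<longlongrightarrow> 0) at_top"
      by (rule Lim_null_comparison[rotated])
        (auto simp: R_def abs_mult intro!: always_eventually mult_left_mono bound)
  qed auto
  have left: "has_bochner_integral lborel (\<lambda>y. indicator {..x} y * (exp ((y - x) / l) * ((w y)\<^sup>2 / 2))) (L x)"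
  proof (rule has_bochner_integral_FTC_atMost[OF finite_Z])
    show "continuous_on UNIV L"
      unfolding L_def using l by (intro continuous_intros p_cont m_cont) auto
    show "(L has_real_derivative (exp ((y - x) / l) * ((w y)\<^sup>2 / 2))) (at y)" if "y \<notin> Z" for y
      unfolding L_def using l
      by (auto intro!: derivative_eq_intros m_deriv' p_deriv that)
        (simp add: field_simps power2_eq_square)
    have "((\<lambda>y. exp ((y - x) / l) * (l * C + B)) \<longlongrightarrow> 0 * (l * C + B)) at_bot"
      using l by (intro tendsto_intros) real_asymp
    then have "((\<lambda>y. exp ((y - x) / l) * (l * C + B)) \<longlongrightarrow> 0) at_bot" by simp
    then show "(L \<longlongrightarrow> 0) at_bot"
      by (rule Lim_null_comparison[rotated])
        (auto simp: L_def abs_mult intro!: always_eventually mult_left_mono bound)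
  qed auto
  have "has_bochner_integral lborel (\<lambda>y. (indicator {x..} y * (exp (- (y - x) / l) * ((w y)\<^sup>2 / 2)) +
      indicator {..x} y * (exp ((y - x) / l) * ((w y)\<^sup>2 / 2))) / (2 * l)) ((R x + L x) / (2 * l))"
    by (intro has_bochner_integral_divide has_bochner_integral_add right left)
  moreover have "(R x + L x) / (2 * l) = p x"
    using l by (simp add: R_def L_def)
  \<comment> \<open>The two half-lines share the point \<open>x\<close>, which is counted twice but
    is a null set.\<close>
  moreover have "AE y in lborel. (indicator {x..} y * (exp (- (y - x) / l) * ((w y)\<^sup>2 / 2)) +
      indicator {..x} y * (exp ((y - x) / l) * ((w y)\<^sup>2 / 2))) / (2 * l) =
      kernel l (x - y) * ((w y)\<^sup>2 / 2)"
    using AE_lborel_singleton[of x]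
  proof eventually_elim
    case (elim y)
    then show ?case
      by (cases "x < y") (auto simp: kernel_def indicator_def abs_if)
  qed
  ultimately show ?thesis
    by (subst has_bochner_integral_cong_AE[symmetric]) (auto simp: kernel_def)
qed

lemma P_w [simp]: "P l w x = p x"
  unfolding P_def using has_bochner_integral_kernel by (rule has_bochner_integral_integral_eq)

lemma P_defined_w [simp]: "P_defined l w x"
  unfolding P_defined_def using has_bochner_integral_kernel by (rule integrable.intros)

lemma momentum_p: "(u x)\<^sup>2 / 2 + l\<^sup>2 * p x = S"
  using l by (simp add: p_def)

lemma energy_p:
  assumes "x \<notin> Z"
  shows "(u x)^3 / 3 + l\<^sup>2 * u x * p x + l\<^sup>2 * u x * (w x)\<^sup>2 / 2 = F"
proof -
  have "l\<^sup>2 * u x * p x = S * u x - (u x)^3 / 2"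
    using l by (simp add: p_def field_simps power2_eq_square power3_eq_cube)
  then show ?thesis
    unfolding w_sq[OF assms] by (simp add: field_simps)
qed

lemma momentum_flux_u: "momentum_flux l u S"
  unfolding momentum_flux_def
proof (intro exI[of _ w] conjI ballI allI)
  fix \<psi> :: "real \<Rightarrow> real" assume \<psi>: "\<psi> \<in> test_functions UNIV"
  obtain a where a: "\<And>x. a < \<bar>x\<bar> \<Longrightarrow> \<psi> x = 0" "\<And>x. a < \<bar>x\<bar> \<Longrightarrow> deriv \<psi> x = 0"
    using \<psi> by (rule test_function_bounds) blast
  show "(LINT x|lborel. ((u x)\<^sup>2 / 2 + l\<^sup>2 * (w x)\<^sup>2 / 2) * \<psi> x + l\<^sup>2 * u x * w x * deriv \<psi> x)
      = (LINT x|lborel. S * \<psi> x)"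
    by (rule momentum_identity[OF test_function_deriv(1)[OF \<psi>]
          test_function_continuous[OF test_function_deriv(2)[OF \<psi>]] a])
qed (simp_all add: weak_deriv_u momentum_p)

lemma energy_flux_u: "energy_flux l u F"
  unfolding energy_flux_def
proof (intro exI[of _ w] conjI ballI allI)
  fix \<psi> :: "real \<Rightarrow> real" assume \<psi>: "\<psi> \<in> test_functions UNIV"
  obtain a where a: "\<And>x. a < \<bar>x\<bar> \<Longrightarrow> \<psi> x = 0" "\<And>x. a < \<bar>x\<bar> \<Longrightarrow> deriv \<psi> x = 0"
    using \<psi> by (rule test_function_bounds) blast
  show "(LINT x|lborel. ((u x)^3 / 3 + 2 * l\<^sup>2 * u x * (w x)\<^sup>2) * \<psi> x + l\<^sup>2 * (u x)\<^sup>2 * w x * deriv \<psi> x)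
      = (LINT x|lborel. F * \<psi> x)"
    by (rule energy_identity[OF test_function_deriv(1)[OF \<psi>]
          test_function_continuous[OF test_function_deriv(2)[OF \<psi>]] a])
next
  show "AE x in lborel. P_defined l w x \<and>
        (u x)^3 / 3 + l\<^sup>2 * u x * P l w x + l\<^sup>2 * u x * (w x)\<^sup>2 / 2 = F"
    using AE_not_Z by eventually_elim (simp add: energy_p)
qed (simp_all add: weak_deriv_u)

end

section \<open>Stationary solutions as functions of time and space\<close>

lemma borel_measurable_snd:
  fixes f :: "real \<Rightarrow> real"
  assumes "f \<in> borel_measurable borel"
  shows "case_prod (\<lambda>_::real. f) \<in> borel_measurable borel"
  unfolding case_prod_unfold
  by (rule measurable_compose[OF borel_measurable_continuous_onI[OF continuous_on_snd[OF continuous_on_id]] assms])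

context stationary
begin

lemma locally_integrable_energy_flux:
  "locally_integrable (\<lambda>x. (u x)^3 / 3 + l\<^sup>2 * u x * p x + l\<^sup>2 * u x * (w x)\<^sup>2 / 2)"
proof -
  have "locally_integrable (\<lambda>x. ((u x)^3 / 3 + l\<^sup>2 * u x * p x) + (l\<^sup>2 * u x / 2) * (w x)\<^sup>2)"
    by (intro locally_integrable_add locally_integrable_mult_continuous[OF w_sq_integrable]
        locally_integrable_continuous continuous_intros u_cont p_cont) auto
  then show ?thesis by simp
qed

text \<open>The terms with a time derivative vanish on integration over \<open>t\<close> at fixed
  \<open>x\<close>. On each time slice the flux terms form the momentum identity for the function
  \<open>dx \<phi>\<close>, whose right-hand side, \<open>S\<close> times the integral of
  \<open>dx \<phi>\<close>, is zero.\<close>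

lemma weak_solution_u: "weak_solution l (\<lambda>t. u)"
  unfolding weak_solution_def
proof (intro exI[of _ "\<lambda>t. w"] conjI allI impI ballI)
  show "case_prod (\<lambda>t::real. u) \<in> borel_measurable borel" "case_prod (\<lambda>t::real. w) \<in> borel_measurable borel"
    by (rule borel_measurable_snd; measurable)+
  fix K :: "(real \<times> real) set" assume K: "compact K"
  show "set_integrable lborel K (\<lambda>(t, x). (u x)\<^sup>2)"
    by (intro set_integrable_compact_snd[OF _ K] locally_integrable_continuous continuous_intros u_cont)
  show "set_integrable lborel K (\<lambda>(t, x). (w x)\<^sup>2)"
    by (intro set_integrable_compact_snd[OF _ K] w_sq_integrable)
next
  show "AE t in lborel. weak_deriv u w" by (simp add: weak_deriv_u)
next
  fix \<phi> :: "real \<times> real \<Rightarrow> real" assume \<phi>: "\<phi> \<in> test_functions UNIV"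
  note test = test_function_pderiv[OF _ Basis_real_prod(1)] test_function_pderiv[OF _ Basis_real_prod(2)]
  obtain a1 where a1: "\<And>t x. a1 < \<bar>t\<bar> \<or> a1 < \<bar>x\<bar> \<Longrightarrow> \<phi> (t, x) = 0"
    using test_function_support2[OF \<phi>] by metis
  obtain a2 where a2: "\<And>t x. a2 < \<bar>t\<bar> \<or> a2 < \<bar>x\<bar> \<Longrightarrow> dt \<phi> (t, x) = 0"
    using test_function_support2[OF test(1)[OF \<phi>]] by metis
  obtain a3 where a3: "\<And>t x. a3 < \<bar>t\<bar> \<or> a3 < \<bar>x\<bar> \<Longrightarrow> dx \<phi> (t, x) = 0"
    using test_function_support2[OF test(2)[OF \<phi>]] by metis
  obtain a4 where a4: "\<And>t x. a4 < \<bar>t\<bar> \<or> a4 < \<bar>x\<bar> \<Longrightarrow> dx (dt \<phi>) (t, x) = 0"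
    using test_function_support2[OF test(2)[OF test(1)[OF \<phi>]]] by metis
  obtain a5 where a5: "\<And>t x. a5 < \<bar>t\<bar> \<or> a5 < \<bar>x\<bar> \<Longrightarrow> dx (dx \<phi>) (t, x) = 0"
    using test_function_support2[OF test(2)[OF test(2)[OF \<phi>]]] by metis
  define a where "a = max a1 (max a3 a5)"
  have a: "\<phi> (t, x) = 0" "dx \<phi> (t, x) = 0" "dx (dx \<phi>) (t, x) = 0" if "a < \<bar>t\<bar> \<or> a < \<bar>x\<bar>" for t x
    using that a1[of t x] a3[of t x] a5[of t x] by (auto simp: a_def)
  note cont = test_function_continuous[OF \<phi>] test_function_continuous[OF test(1)[OF \<phi>]]
    test_function_continuous[OF test(2)[OF \<phi>]]
    test_function_continuous[OF test(2)[OF test(1)[OF \<phi>]]]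
    test_function_continuous[OF test(2)[OF test(2)[OF \<phi>]]]
  have lu: "locally_integrable u" and lm: "locally_integrable (\<lambda>x. l\<^sup>2 * m x)"
    by (intro locally_integrable_continuous continuous_intros u_cont m_cont)+
  have lw: "locally_integrable (\<lambda>x. l\<^sup>2 * w x)"
    by (intro locally_integrable_mult_continuous w_integrable continuous_intros)
  note tensor = integral_tensor[where T = UNIV, simplified]
  note int = integrable_tensor[where T = UNIV, simplified]
  have dt0: "(LINT t|lborel. dt \<phi> (t, x)) = 0" for x
    by (rule integral_deriv_compact_support(1)[where a = "max a1 a2",
          OF test_function_dt[OF \<phi>] continuous_on_slices(2)[OF cont(2)]]) (auto simp: a1 a2)
  have dx0: "(LINT x|lborel. dx \<phi> (t, x)) = 0" for t
    by (rule integral_deriv_compact_support(1)[where a = a,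
          OF test_function_dx[OF \<phi>] continuous_on_slices(1)[OF cont(3)]]) (auto simp: a)
  let ?T1 = "\<lambda>(t, x). u x * dt \<phi> (t, x)" and ?T2 = "\<lambda>(t, x). l\<^sup>2 * w x * dx (dt \<phi>) (t, x)"
    and ?T3 = "\<lambda>(t, x). ((u x)\<^sup>2 / 2 + l\<^sup>2 * (w x)\<^sup>2 / 2) * dx \<phi> (t, x)"
    and ?T4 = "\<lambda>(t, x). l\<^sup>2 * m x * dx (dx \<phi>) (t, x)"
  have T1: "integral\<^sup>L lborel ?T1 = 0" and I1: "integrable lborel ?T1"
    using tensor(1)[OF lu cont(2) a2] int[OF lu cont(2) a2] dt0 by (simp_all add: set_lebesgue_integral_def)
  have T2: "integral\<^sup>L lborel ?T2 = 0" and I2: "integrable lborel ?T2"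
    using tensor(1)[OF lw cont(4) a4] int[OF lw cont(4) a4] integral_dx_dt_test_function[OF \<phi>]
    by (simp_all add: set_lebesgue_integral_def)
  have I3: "integrable lborel ?T3" and I4: "integrable lborel ?T4"
    using int[OF locally_integrable_energy cont(3) a3] int[OF lm cont(5) a5] by simp_all
  have T34: "integral\<^sup>L lborel ?T3 + integral\<^sup>L lborel ?T4 = 0"
  proof -
    have "(LINT x|lborel. ((u x)\<^sup>2 / 2 + l\<^sup>2 * (w x)\<^sup>2 / 2) * dx \<phi> (t, x)) =
        - (LINT x|lborel. l\<^sup>2 * m x * dx (dx \<phi>) (t, x))" for t
    proof -
      have "(LINT x|lborel. ((u x)\<^sup>2 / 2 + l\<^sup>2 * (w x)\<^sup>2 / 2) * dx \<phi> (t, x) + l\<^sup>2 * u x * w x * dx (dx \<phi>) (t, x)) =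
          (LINT x|lborel. S * dx \<phi> (t, x))"
        by (rule momentum_identity[where a = a, OF test_function_dx[OF test(2)[OF \<phi>]]
              continuous_on_slices(1)[OF cont(5)]]) (auto simp: a)
      also have "(\<lambda>x. ((u x)\<^sup>2 / 2 + l\<^sup>2 * (w x)\<^sup>2 / 2) * dx \<phi> (t, x) + l\<^sup>2 * u x * w x * dx (dx \<phi>) (t, x)) =
          (\<lambda>x. ((u x)\<^sup>2 / 2 + l\<^sup>2 * (w x)\<^sup>2 / 2) * dx \<phi> (t, x) + l\<^sup>2 * m x * dx (dx \<phi>) (t, x))"
        by (simp only: mult.assoc[symmetric] u_w[symmetric])
      also have "(LINT x|lborel. ((u x)\<^sup>2 / 2 + l\<^sup>2 * (w x)\<^sup>2 / 2) * dx \<phi> (t, x) + l\<^sup>2 * m x * dx (dx \<phi>) (t, x)) =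
          (LINT x|lborel. ((u x)\<^sup>2 / 2 + l\<^sup>2 * (w x)\<^sup>2 / 2) * dx \<phi> (t, x)) +
          (LINT x|lborel. l\<^sup>2 * m x * dx (dx \<phi>) (t, x))"
        by (intro Bochner_Integration.integral_add locally_integrable_compact_support(1)[where a = a]
            locally_integrable_energy lm continuous_on_slices cont) (auto simp: a)
      finally show ?thesis using dx0[of t] by simp
    qed
    then show ?thesis
      using tensor(2)[OF locally_integrable_energy cont(3) a3] tensor(2)[OF lm cont(5) a5]
      by (simp add: set_lebesgue_integral_def)
  qed
  have "(LINT (t, x)|lborel. u x * dt \<phi> (t, x) + l\<^sup>2 * w x * dx (dt \<phi>) (t, x)
      + ((u x)\<^sup>2 / 2 + l\<^sup>2 * (w x)\<^sup>2 / 2) * dx \<phi> (t, x) + l\<^sup>2 * u x * w x * dx (dx \<phi>) (t, x)) =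
      (LINT q|lborel. ?T1 q + ?T2 q + ?T3 q + ?T4 q)"
    by (rule Bochner_Integration.integral_cong)
      (auto simp del: u_w simp: u_w[symmetric] mult.assoc)
  also have "\<dots> = integral\<^sup>L lborel ?T1 + integral\<^sup>L lborel ?T2 + integral\<^sup>L lborel ?T3 + integral\<^sup>L lborel ?T4"
    by (subst Bochner_Integration.integral_add;
        (intro Bochner_Integration.integrable_add I1 I2 I3 I4)?)+ simp
  finally show "(LINT (t, x)|lborel. u x * dt \<phi> (t, x) + l\<^sup>2 * w x * dx (dt \<phi>) (t, x)
      + ((u x)\<^sup>2 / 2 + l\<^sup>2 * (w x)\<^sup>2 / 2) * dx \<phi> (t, x) + l\<^sup>2 * u x * w x * dx (dx \<phi>) (t, x)) = 0"
    using T1 T2 T34 by simp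
qed

lemma conservative_u: "conservative_solution l u (\<lambda>t. u)"
  unfolding conservative_solution_def
proof (intro exI[of _ "\<lambda>t. w"] conjI allI impI ballI)
  have lu: "locally_integrable u"
    by (intro locally_integrable_continuous u_cont)
  have L2: "L2_loc u" "L2_loc w"
    using weak_deriv_u by (auto simp: weak_deriv_def)
  show "L2_loc u" by fact
  have [measurable]: "{0::real..} \<times> (UNIV :: real set) \<in> sets borel"
    by (intro borel_closed closed_Times) auto
  have "case_prod (\<lambda>t::real. u) \<in> borel_measurable borel"
    by (rule borel_measurable_snd) measurable
  then show "set_borel_measurable borel ({0..} \<times> UNIV) (case_prod (\<lambda>t::real. u))"
    unfolding set_borel_measurable_def by measurable
  show "case_prod (\<lambda>t::real. w) \<in> borel_measurable borel"
    by (rule borel_measurable_snd) measurable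
  show "AE t in lborel. 0 \<le> t \<longrightarrow> weak_deriv u w" by (simp add: weak_deriv_u)
  show "Lip_L2_loc T (\<lambda>t. u)" for T
    unfolding Lip_L2_loc_def using L2 by (auto intro!: exI[of _ 0] simp: set_lebesgue_integral_def)
  show "Linf_L2_loc T (\<lambda>t. w)" for T
    unfolding Linf_L2_loc_def using L2 by blast
  show "AE (t, x) in lborel. 0 \<le> t \<longrightarrow> P_defined l w x" by simp
next
  fix K :: "(real \<times> real) set" assume "compact K \<and> K \<subseteq> {0..} \<times> UNIV"
  then have K: "compact K" by simp
  show "set_integrable lborel K (\<lambda>(t, x). (u x)\<^sup>2 / 2 + l\<^sup>2 * P l w x)"
    by (intro set_integrable_compact_snd[OF _ K] locally_integrable_continuous)
      (simp add: momentum_p)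
  show "set_integrable lborel K (\<lambda>(t, x). (u x)\<^sup>2 / 2 + l\<^sup>2 * (w x)\<^sup>2 / 2)"
    by (intro set_integrable_compact_snd[OF _ K] locally_integrable_energy)
  show "set_integrable lborel K (\<lambda>(t, x). (u x)^3 / 3 + l\<^sup>2 * u x * P l w x + l\<^sup>2 * u x * (w x)\<^sup>2 / 2)"
    using set_integrable_compact_snd[OF locally_integrable_energy_flux K] by simp
next
  \<comment> \<open>Both equations have a time-independent density \<open>g\<close> and a flux
    \<open>h\<close> that is constant almost everywhere: \<open>u\<close> with \<open>S\<close>, and
    the energy density with \<open>F\<close>. Only the contribution of time 0 survives.\<close>
  have tensor: "(LINT q:{0..} \<times> UNIV|lborel. (case q of (t, x) \<Rightarrow> g x * dt \<phi> (t, x) + h x * dx \<phi> (t, x))) =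
      - (LINT x|lborel. g x * \<phi> (0, x))"
    if g: "locally_integrable g" and h: "locally_integrable h" and AE: "AE x in lborel. h x = c"
      and \<phi>: "\<phi> \<in> test_functions \<Omega>" for g h c \<phi> \<Omega>
  proof -
    note test = test_function_pderiv[OF \<phi> Basis_real_prod(1)] test_function_pderiv[OF \<phi> Basis_real_prod(2)]
    obtain a1 where a1: "\<And>t x. a1 < \<bar>t\<bar> \<or> a1 < \<bar>x\<bar> \<Longrightarrow> \<phi> (t, x) = 0"
      using test_function_support2[OF \<phi>] by metis
    obtain a2 where a2: "\<And>t x. a2 < \<bar>t\<bar> \<or> a2 < \<bar>x\<bar> \<Longrightarrow> dt \<phi> (t, x) = 0"
      using test_function_support2[OF test(1)] by metis
    obtain a3 where a3: "\<And>t x. a3 < \<bar>t\<bar> \<or> a3 < \<bar>x\<bar> \<Longrightarrow> dx \<phi> (t, x) = 0"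
      using test_function_support2[OF test(2)] by metis
    note cont = test[THEN test_function_continuous]
    have dt0: "(LINT t:{0..}|lborel. dt \<phi> (t, x)) = - \<phi> (0, x)" for x
      by (rule integral_deriv_compact_support(2)[where a = "max a1 a2",
            OF test_function_dt[OF \<phi>] continuous_on_slices(2)[OF cont(1)]]) (auto simp: a1 a2)
    have dx0: "(LINT x|lborel. dx \<phi> (t, x)) = 0" for t
      by (rule integral_deriv_compact_support(1)[where a = "max a1 a3",
            OF test_function_dx[OF \<phi>] continuous_on_slices(1)[OF cont(2)]]) (auto simp: a1 a3)
    have A: "{0::real..} \<in> sets borel" by simp
    have lc: "locally_integrable (\<lambda>_. c)" by (intro locally_integrable_continuous continuous_intros)
    have [measurable]: "h \<in> borel_measurable borel" "dx \<phi> \<in> borel_measurable (borel \<Otimes>\<^sub>M borel)"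
      using h cont(2) by (auto simp: locally_integrable_measurable borel_prod intro: borel_measurable_continuous_onI)
    \<comment> \<open>Fubini is used in both directions: with \<open>t\<close> innermost,
      \<open>h\<close> may be replaced by \<open>c\<close> off a null set of \<open>x\<close>; with
      \<open>x\<close> innermost, the constant leaves the integral of a derivative, which is
      zero.\<close>
    have "(LINT (t, x)|lborel. indicator {0..} t * (h x * dx \<phi> (t, x))) =
        (LINT x|lborel. h x * (LINT t:{0..}|lborel. dx \<phi> (t, x)))"
      by (rule integral_tensor(1)[OF h cont(2) a3 A])
    also have "\<dots> = (LINT x|lborel. c * (LINT t:{0..}|lborel. dx \<phi> (t, x)))"
    proof (rule integral_cong_AE)
      show "AE x in lborel. h x * (LINT t:{0..}|lborel. dx \<phi> (t, x)) = c * (LINT t:{0..}|lborel. dx \<phi> (t, x))"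
        using AE by eventually_elim simp
    qed (unfold set_lebesgue_integral_def, measurable)
    also have "\<dots> = (LINT t:{0..}|lborel. LINT x|lborel. c * dx \<phi> (t, x))"
      by (rule trans[OF integral_tensor(1)[OF lc cont(2) a3 A, symmetric]
            integral_tensor(2)[OF lc cont(2) a3 A]])
    also have "\<dots> = 0" by (simp add: dx0 set_lebesgue_integral_def)
    finally have h0: "(LINT (t, x)|lborel. indicator {0..} t * (h x * dx \<phi> (t, x))) = 0" .
    have "(LINT q:{0..} \<times> UNIV|lborel. (case q of (t, x) \<Rightarrow> g x * dt \<phi> (t, x) + h x * dx \<phi> (t, x))) =
        (LINT q|lborel. (\<lambda>(t, x). indicator {0..} t * (g x * dt \<phi> (t, x))) q
          + (\<lambda>(t, x). indicator {0..} t * (h x * dx \<phi> (t, x))) q)"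
      unfolding set_lebesgue_integral_def
      by (rule Bochner_Integration.integral_cong) (auto simp: indicator_times algebra_simps)
    also have "\<dots> = (LINT (t, x)|lborel. indicator {0..} t * (g x * dt \<phi> (t, x)))
        + (LINT (t, x)|lborel. indicator {0..} t * (h x * dx \<phi> (t, x)))"
      by (intro Bochner_Integration.integral_add integrable_tensor[OF g cont(1) a2 A]
          integrable_tensor[OF h cont(2) a3 A])
    also have "\<dots> = - (LINT x|lborel. g x * \<phi> (0, x))"
      using integral_tensor(1)[OF g cont(1) a2 A] by (simp add: dt0 h0)
    finally show ?thesis .
  qed
  show "(LINT q:{0..} \<times> UNIV|lborel. (case q of (t, x) \<Rightarrow>
        u x * dt \<phi> (t, x) + ((u x)\<^sup>2 / 2 + l\<^sup>2 * P l w x) * dx \<phi> (t, x)))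
      + (LINT x|lborel. u x * \<phi> (0, x)) = 0" if "\<phi> \<in> test_functions UNIV" for \<phi>
    using tensor[of u "\<lambda>_. S" S \<phi>] that u_cont
    by (simp add: momentum_p locally_integrable_continuous)
  show "(LINT q:{0..} \<times> UNIV|lborel. (case q of (t, x) \<Rightarrow>
        ((u x)\<^sup>2 / 2 + l\<^sup>2 * (w x)\<^sup>2 / 2) * dt \<phi> (t, x)
        + ((u x)^3 / 3 + l\<^sup>2 * u x * P l w x + l\<^sup>2 * u x * (w x)\<^sup>2 / 2) * dx \<phi> (t, x))) = 0"
    if \<phi>: "\<phi> \<in> test_functions ({0<..} \<times> UNIV)" for \<phi>
  proof -
    \<comment> \<open>The support lies in the open half-plane, so the initial term
      disappears.\<close>
    have "\<phi> (0, x) = 0" for x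
      using \<phi> closure_subset[of "{q. \<phi> q \<noteq> 0}"] by (auto simp: test_functions_def)
    moreover have "AE x in lborel. (u x)^3 / 3 + l\<^sup>2 * u x * p x + l\<^sup>2 * u x * (w x)\<^sup>2 / 2 = F"
      using AE_not_Z by eventually_elim (rule energy_p)
    ultimately show ?thesis
      using tensor[OF locally_integrable_energy locally_integrable_energy_flux _ \<phi>] by simp
  qed
qed

end

section \<open>The profile\<close>

text \<open>For \<open>0 < v < u0\<close> this is \<open>v / sqrt (K u0 u1 v)\<close> with the
  quartic \<open>K\<close> below, the reciprocal of the slope of the profile at height
  \<open>v\<close>. At \<open>v = u0\<close> division by zero gives the value 0.\<close>

definition integrand :: "real \<Rightarrow> real \<Rightarrow> real \<Rightarrow> real" where
  "integrand u0 u1 v = sqrt (3 * v / ((u0 - v) * (u1 - v) * (u0 + u1 + v)))"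

locale amplitude_pair =
  fixes u0 u1 :: real
  assumes u0_pos: "0 < u0" and u0_le_u1: "u0 \<le> u1"
begin

abbreviation "h \<equiv> integrand u0 u1"

lemma h_measurable [measurable]: "h \<in> borel_measurable borel"
  unfolding integrand_def by measurable

lemma h_nonneg: "0 \<le> v \<Longrightarrow> v \<le> u0 \<Longrightarrow> 0 \<le> h v"
  using u0_pos u0_le_u1 by (auto simp: integrand_def intro!: divide_nonneg_nonneg mult_nonneg_nonneg)

lemma h_pos: "0 < v \<Longrightarrow> v < u0 \<Longrightarrow> 0 < h v"
  using u0_pos u0_le_u1 by (auto simp: integrand_def intro!: divide_pos_pos mult_pos_pos)

lemma h_cont: "v < u0 \<Longrightarrow> continuous_on {0..v} h"
  unfolding integrand_def using u0_pos u0_le_u1 by (intro continuous_intros) auto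

lemma H_eq: "H u0 u1 v = (\<integral>\<^sup>+y. ennreal (indicator {0..v} y *\<^sub>R h y) \<partial>lborel)"
  unfolding H_def integrand_def by (intro nn_integral_cong) (auto simp: indicator_def)

lemma H_mono: "a \<le> b \<Longrightarrow> H u0 u1 a \<le> H u0 u1 b"
  unfolding H_def by (intro nn_integral_mono) (auto simp: indicator_def)

lemma set_integrable_h:
  assumes "v \<le> u0" and "H u0 u1 v < \<infinity>"
  shows "set_integrable lborel {0..v} h"
  unfolding set_integrable_def
proof (rule integrableI_nonneg)
  show "AE x in lborel. 0 \<le> indicat_real {0..v} x *\<^sub>R h x"
    using assms(1) by (auto simp: indicator_def intro!: h_nonneg)
qed (use assms(2) in \<open>auto simp: H_eq\<close>)

lemma H_eq_integral:
  assumes v: "v \<le> u0" and "set_integrable lborel {0..v} h"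
  shows "H u0 u1 v = ennreal (integral {0..v} h)"
proof -
  have "H u0 u1 v = ennreal (LINT y:{0..v}|lborel. h y)"
    unfolding H_eq set_lebesgue_integral_def
    by (rule nn_integral_eq_integral)
      (use assms in \<open>auto simp: set_integrable_def indicator_def intro!: h_nonneg\<close>)
  then show ?thesis
    using set_borel_integral_eq_integral(2)[OF assms(2)] by simp
qed

lemma set_integrable_h_less: "v < u0 \<Longrightarrow> set_integrable lborel {0..v} h"
  by (intro borel_integrable_atLeastAtMost' h_cont)

lemma H_less: "v < u0 \<Longrightarrow> H u0 u1 v = ennreal (integral {0..v} h)"
  by (intro H_eq_integral set_integrable_h_less) auto

lemma H_0 [simp]: "H u0 u1 0 = 0"
  using H_less[of 0] u0_pos by simp

lemma integral_h_deriv: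
  assumes "0 < y" "y < u0"
  shows "((\<lambda>y. integral {0..y} h) has_real_derivative h y) (at y)"
proof -
  have "((\<lambda>y. integral {0..y} h) has_real_derivative h y) (at y within {0..(y + u0) / 2})"
    using assms by (intro integral_has_real_derivative h_cont) auto
  moreover have "y \<in> {0<..<(y + u0) / 2}" using assms by auto
  ultimately show ?thesis by (simp add: at_within_Icc_at)
qed

lemma integral_h_cont:
  assumes "v \<le> u0" "set_integrable lborel {0..v} h"
  shows "continuous_on {0..v} (\<lambda>y. integral {0..y} h)"
  by (intro indefinite_integral_continuous_1 set_borel_integral_eq_integral(1) assms)

lemma H_strict_mono:
  assumes "0 \<le> a" "a < b" "b \<le> u0"
  shows "H u0 u1 a < H u0 u1 b"
proof -
  \<comment> \<open>At \<open>b = u0\<close> the value of \<open>H\<close> may be infinite; the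
    midpoint stays below u0, where \<open>H\<close> is an ordinary integral.\<close>
  define c where "c = (a + b) / 2"
  have c: "a < c" "c < b" using assms by (auto simp: c_def)
  have "integral {0..a} h < integral {0..c} h"
  proof (rule DERIV_pos_imp_increasing_open[OF c(1)])
    show "continuous_on {a..c} (\<lambda>y. integral {0..y} h)"
      by (rule continuous_on_subset[OF integral_h_cont[of c]])
        (use assms c set_integrable_h_less in auto)
    fix x assume "a < x" "x < c"
    then show "\<exists>y. ((\<lambda>y. integral {0..y} h) has_real_derivative y) (at x) \<and> 0 < y"
      using assms c by (intro exI[of _ "h x"] conjI integral_h_deriv h_pos) auto
  qed
  moreover have "0 \<le> integral {0..a} h"
    using assms set_borel_integral_eq_integral(1)[OF set_integrable_h_less[of a]]
    by (intro Henstock_Kurzweil_Integration.integral_nonneg h_nonneg) auto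
  ultimately have "H u0 u1 a < H u0 u1 c"
    using assms c by (simp add: H_less ennreal_less_iff)
  also have "\<dots> \<le> H u0 u1 b"
    using c by (intro H_mono) auto
  finally show ?thesis .
qed

lemma H_inj: "a \<in> {0..u0} \<Longrightarrow> b \<in> {0..u0} \<Longrightarrow> H u0 u1 a = H u0 u1 b \<Longrightarrow> a = b"
  using H_strict_mono[of a b] H_strict_mono[of b a] by (cases a b rule: linorder_cases) auto

lemma H_surj:
  assumes v: "0 \<le> v" "v \<le> u0" and "H u0 u1 v < \<infinity>" and x: "0 \<le> x" "ennreal x \<le> H u0 u1 v"
  obtains y where "y \<in> {0..v}" "H u0 u1 y = ennreal x"
proof -
  note int = set_integrable_h[OF v(2) assms(3)]
  have "0 \<le> integral {0..v} h"
    using v set_borel_integral_eq_integral(1)[OF int]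
    by (intro Henstock_Kurzweil_Integration.integral_nonneg h_nonneg) auto
  then have "x \<le> integral {0..v} h"
    using x(2) unfolding H_eq_integral[OF v(2) int] by simp
  then obtain y where y: "0 \<le> y" "y \<le> v" "integral {0..y} h = x"
    using IVT'[of "\<lambda>y. integral {0..y} h" 0 x v] x v integral_h_cont[OF v(2) int] by auto
  have "H u0 u1 y = ennreal x"
    using H_eq_integral[of y] set_integrable_subset[OF int, of "{0..y}"] y v by auto
  then show ?thesis using y that by auto
qed

lemma xstar_pos: "0 < xstar u0 u1"
  using H_strict_mono[of 0 u0] u0_pos by (simp add: xstar_def)

text \<open>The denominator has a simple zero at u0, so the integrand is of the order
  \<open>1 / sqrt (u0 - v)\<close>, which is integrable.\<close>

lemma xstar_finite:
  assumes "u0 < u1"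
  shows "xstar u0 u1 < \<infinity>"
proof -
  \<comment> \<open>From \<open>v \<le> u0\<close>, \<open>u1 - v \<ge> u1 - u0\<close> and
    \<open>u0 + u1 + v \<ge> u0\<close> under the root.\<close>
  define C where "C = sqrt (3 / (u1 - u0))"
  have "set_integrable lborel {0..u0} (\<lambda>v. C / sqrt (u0 - v))"
  proof (rule FTC_nonneg_integrable[where Z = "{}" and f = "\<lambda>v. - 2 * C * sqrt (u0 - v)"])
    show "continuous_on {0..u0} (\<lambda>v. - 2 * C * sqrt (u0 - v))"
      by (intro continuous_intros)
    show "((\<lambda>v. - 2 * C * sqrt (u0 - v)) has_real_derivative C / sqrt (u0 - x)) (at x)"
      if "x \<in> {0<..<u0} - {}" for x
      using that by (auto intro!: derivative_eq_intros simp: field_simps)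
  qed (use u0_pos assms in \<open>auto simp: C_def\<close>)
  then have "set_integrable lborel {0..u0} h"
  proof (rule set_integrable_bound)
    show "AE x in lborel. x \<in> {0..u0} \<longrightarrow> norm (h x) \<le> norm (C / sqrt (u0 - x))"
      using AE_lborel_singleton[of u0]
    proof eventually_elim
      case (elim x)
      have "norm (h x) \<le> norm (C / sqrt (u0 - x))" if x: "x \<in> {0..<u0}"
      proof -
        have "3 * x / ((u0 - x) * (u1 - x) * (u0 + u1 + x)) \<le> 3 * u0 / ((u0 - x) * (u1 - u0) * u0)"
          using x assms u0_pos by (intro frac_le mult_mono mult_pos_pos mult_nonneg_nonneg) auto
        also have "\<dots> = 3 / (u1 - u0) / (u0 - x)"
          using u0_pos by (simp add: mult_ac)
        finally have "h x \<le> sqrt (3 / (u1 - u0) / (u0 - x))"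
          unfolding integrand_def by (rule real_sqrt_le_mono)
        then have "h x \<le> C / sqrt (u0 - x)"
          by (simp add: C_def real_sqrt_divide real_sqrt_mult)
        moreover have "0 \<le> C" using assms by (simp add: C_def)
        ultimately show ?thesis using h_nonneg[of x] x by simp
      qed
      then show ?case using elim by auto
    qed
  qed (simp add: set_borel_measurable_def)
  from H_eq_integral[OF order_refl this] show ?thesis
    by (simp add: xstar_def)
qed

text \<open>The denominator has a double zero at u0, and on the upper half of the range the
  integrand is at least \<open>1 / (2 * (u0 - y))\<close>, whose integral diverges
  logarithmically.\<close>

lemma H_unbounded:
  assumes "u0 = u1" and "0 \<le> x"
  obtains v where "0 \<le> v" "v < u0" "ennreal x \<le> H u0 u1 v"
proof -
  \<comment> \<open>Chosen so that the integral of \<open>1 / (2 * (u0 - y))\<close> from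
    \<open>u0 / 2\<close> to \<open>v\<close> is exactly \<open>x\<close>.\<close>
  define v where "v = u0 - u0 / 2 * exp (- 2 * x)"
  have v: "u0 / 2 \<le> v" "v < u0"
    using u0_pos assms(2) by (auto simp: v_def)
  have pos: "u0 - y > 0" if "y \<le> v" for y using that v by auto
  have int: "set_integrable lborel {u0/2..v} (\<lambda>y. 1 / (2 * (u0 - y)))"
    using pos by (intro borel_integrable_atLeastAtMost' continuous_intros) fastforce
  have "(LINT y:{u0/2..v}|lborel. 1 / (2 * (u0 - y))) = - ln (u0 - v) / 2 - (- ln (u0 - u0 / 2) / 2)"
  proof (rule FTC_finite_exceptions[where Z = "{}" and f = "\<lambda>y. - ln (u0 - y) / 2", OF v(1)])
    show "continuous_on {u0 / 2..v} (\<lambda>y. - ln (u0 - y) / 2)"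
      using pos by (intro continuous_intros) fastforce+
    show "((\<lambda>y. - ln (u0 - y) / 2) has_real_derivative 1 / (2 * (u0 - y))) (at y)"
      if "y \<in> {u0/2<..<v} - {}" for y
      using that pos[of y] by (auto intro!: derivative_eq_intros simp: field_simps)
  qed (use int in auto)
  also have "\<dots> = x"
    using u0_pos by (simp add: v_def ln_mult ln_div field_simps)
  finally have "x = (LINT y:{u0/2..v}|lborel. 1 / (2 * (u0 - y)))" by simp
  also have "\<dots> \<le> (LINT y:{u0/2..v}|lborel. h y)"
  proof (rule set_integral_mono[OF int])
    show "set_integrable lborel {u0 / 2..v} h"
      by (rule set_integrable_subset[OF set_integrable_h_less[OF v(2)]]) (use u0_pos in auto)
    fix y assume y: "y \<in> {u0/2..v}"
    have "(1 / (2 * (u0 - y)))\<^sup>2 = 1 / 4 / (u0 - y)\<^sup>2"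
      by (simp add: power_divide power_mult_distrib del: right_diff_distrib_numeral)
    \<comment> \<open>For \<open>u1 = u0\<close> and \<open>y \<ge> u0 / 2\<close> the first
      quotient is at least 3/5.\<close>
    also have "\<dots> \<le> 3 * y / (u0 + u1 + y) / (u0 - y)\<^sup>2"
      using y v u0_pos assms by (intro divide_right_mono) (auto simp: field_simps)
    also have "\<dots> = 3 * y / ((u0 - y) * (u1 - y) * (u0 + u1 + y))"
      using assms by (simp add: power2_eq_square mult_ac)
    finally show "1 / (2 * (u0 - y)) \<le> h y"
      unfolding integrand_def by (rule real_le_rsqrt)
  qed
  also have "\<dots> \<le> (LINT y:{0..v}|lborel. h y)"
    unfolding set_lebesgue_integral_def
  proof (rule integral_mono)
    show "integrable lborel (\<lambda>y. indicat_real {0..v} y *\<^sub>R h y)"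
      using set_integrable_h_less[OF v(2)] by (simp add: set_integrable_def)
    have "set_integrable lborel {u0 / 2..v} h"
      by (rule set_integrable_subset[OF set_integrable_h_less[OF v(2)]]) (use u0_pos in auto)
    then show "integrable lborel (\<lambda>y. indicat_real {u0 / 2..v} y *\<^sub>R h y)"
      by (simp add: set_integrable_def)
  qed (use u0_pos v in \<open>auto simp: indicator_def intro!: h_nonneg\<close>)
  also have "\<dots> = integral {0..v} h"
    by (rule set_borel_integral_eq_integral(2)[OF set_integrable_h_less[OF v(2)]])
  finally have "ennreal x \<le> H u0 u1 v"
    unfolding H_less[OF v(2)] by (rule ennreal_leI)
  then show ?thesis using that[of v] v u0_pos by auto
qed

lemma xstar_infinite:
  assumes "u0 = u1"
  shows "xstar u0 u1 = \<infinity>"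
proof -
  have "of_nat n \<le> xstar u0 u1" for n
  proof -
    obtain v where "v < u0" "ennreal (real n) \<le> H u0 u1 v"
      using H_unbounded[OF assms, of "real n"] by auto
    then show ?thesis
      using H_mono[of v u0] by (auto simp: xstar_def ennreal_of_nat_eq_real_of_nat)
  qed
  then show ?thesis
    by (metis ennreal_Ex_less_of_nat infinity_ennreal_def linorder_not_le top.not_eq_extremum)
qed

lemma ex_profile: "\<exists>\<eta>. profile u0 u1 \<eta>"
proof -
  define \<eta> where "\<eta> x = (SOME y. y \<in> {0..u0} \<and> H u0 u1 y = ennreal x)" for x
  have \<eta>: "\<eta> x \<in> {0..u0} \<and> H u0 u1 (\<eta> x) = ennreal x"
    if x: "0 \<le> x" "ennreal x \<le> xstar u0 u1" for x
    unfolding \<eta>_def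
  proof (rule someI_ex)
    \<comment> \<open>The intermediate value theorem needs a finite value of \<open>H\<close> at the
      right end: u0 itself when \<open>u0 < u1\<close>, otherwise a point below u0 that depends on
      \<open>x\<close>.\<close>
    show "\<exists>y. y \<in> {0..u0} \<and> H u0 u1 y = ennreal x"
    proof (cases "u0 = u1")
      case True
      obtain v where v: "0 \<le> v" "v < u0" "ennreal x \<le> H u0 u1 v"
        using H_unbounded[OF True x(1)] by blast
      then obtain y where "y \<in> {0..v}" "H u0 u1 y = ennreal x"
        using H_surj[of v x] x(1) by (metis H_less ennreal_less_top infinity_ennreal_def less_imp_le)
      then show ?thesis
        using v by auto
    next
      case False
      then have "H u0 u1 u0 < \<infinity>"
        using xstar_finite u0_le_u1 by (simp add: xstar_def)
      then obtain y where "y \<in> {0..u0}" "H u0 u1 y = ennreal x"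
        using H_surj[of u0 x] x u0_pos by (metis less_imp_le order_refl xstar_def)
      then show ?thesis by auto
    qed
  qed
  have "\<eta> (enn2real (xstar u0 u1)) = u0" if "xstar u0 u1 < \<infinity>"
    using \<eta>[of "enn2real (xstar u0 u1)"] that u0_pos
    by (intro H_inj) (auto simp: xstar_def)
  then have "profile u0 u1 \<eta>"
    unfolding profile_def using \<eta> by auto
  then show ?thesis by blast
qed

end

section \<open>The profile as an inverse function\<close>

locale profile_function = amplitude_pair +
  fixes \<eta> :: "real \<Rightarrow> real"
  assumes profile: "profile u0 u1 \<eta>"
begin

lemma eta_range: "0 \<le> x \<Longrightarrow> ennreal x < xstar u0 u1 \<Longrightarrow> \<eta> x \<in> {0..u0}"
  and H_eta: "0 \<le> x \<Longrightarrow> ennreal x < xstar u0 u1 \<Longrightarrow> H u0 u1 (\<eta> x) = ennreal x"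
  and eta_xstar: "xstar u0 u1 < \<infinity> \<Longrightarrow> \<eta> (enn2real (xstar u0 u1)) = u0"
  using profile by (auto simp: profile_def)

lemma eta_0 [simp]: "\<eta> 0 = 0"
  using eta_range[of 0] H_eta[of 0] xstar_pos u0_pos by (intro H_inj) auto

lemma eta_interior:
  assumes "0 < x" "ennreal x < xstar u0 u1"
  shows "0 < \<eta> x" "\<eta> x < u0"
proof -
  have "\<eta> x \<noteq> 0" "\<eta> x \<noteq> u0"
    using H_eta[of x] assms by (auto simp: xstar_def)
  then show "0 < \<eta> x" "\<eta> x < u0"
    using eta_range[of x] assms by auto
qed

lemma eta_H:
  assumes "y \<in> {0..u0}" "H u0 u1 y < \<infinity>"
  shows "\<eta> (enn2real (H u0 u1 y)) = y"
proof (cases "y = u0")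
  case True
  then show ?thesis using eta_xstar assms by (simp add: xstar_def)
next
  case False
  then have "ennreal (enn2real (H u0 u1 y)) < xstar u0 u1"
    using H_strict_mono[of y u0] assms by (simp add: xstar_def)
  then show ?thesis
    using eta_range[of "enn2real (H u0 u1 y)"] H_eta[of "enn2real (H u0 u1 y)"] assms
    by (intro H_inj) auto
qed

text \<open>The inverse of a continuous injection on a compact interval is continuous. The end point
  \<open>v\<close> is left free: for \<open>u0 = u1\<close> only \<open>v < u0\<close> gives a
  finite \<open>H\<close>, while for \<open>u0 < u1\<close> the choice \<open>v = u0\<close> covers
  the closed interval up to \<open>xstar\<close>.\<close>

lemma eta_cont:
  assumes v: "v \<in> {0..u0}" "H u0 u1 v < \<infinity>"
  shows "continuous_on {0..enn2real (H u0 u1 v)} \<eta>"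
proof -
  have vu: "v \<le> u0" using v by auto
  note int = set_integrable_h[OF vu v(2)]
  have fin: "H u0 u1 y < \<infinity>" if "y \<in> {0..v}" for y
    using that v(2) H_mono[of y v] by (auto intro: le_less_trans)
  have f: "enn2real (H u0 u1 y) = integral {0..y} h" if "y \<in> {0..v}" for y
  proof -
    have "set_integrable lborel {0..y} h"
      using that by (intro set_integrable_subset[OF int]) auto
    moreover from this have "0 \<le> integral {0..y} h"
      using that vu set_borel_integral_eq_integral(1)
      by (intro Henstock_Kurzweil_Integration.integral_nonneg h_nonneg) auto
    ultimately show ?thesis
      using H_eq_integral[of y] that vu by simp
  qed
  have "continuous_on {0..v} (\<lambda>y. enn2real (H u0 u1 y))"
    using integral_h_cont[OF vu int] f by (metis (no_types, lifting) continuous_on_cong)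
  then have "continuous_on ((\<lambda>y. enn2real (H u0 u1 y)) ` {0..v}) \<eta>"
    by (rule continuous_on_inv) (use v fin in \<open>auto intro!: eta_H\<close>)
  moreover have "{0..enn2real (H u0 u1 v)} \<subseteq> (\<lambda>y. enn2real (H u0 u1 y)) ` {0..v}"
  proof
    fix x assume x: "x \<in> {0..enn2real (H u0 u1 v)}"
    then have "ennreal x \<le> H u0 u1 v"
      using ennreal_leI[of x "enn2real (H u0 u1 v)"] ennreal_enn2real[of "H u0 u1 v"] v(2)
      by (simp del: ennreal_le_iff)
    then obtain y where "y \<in> {0..v}" "H u0 u1 y = ennreal x"
      using H_surj[of v x] v x by auto
    then show "x \<in> (\<lambda>y. enn2real (H u0 u1 y)) ` {0..v}"
      using x by (intro image_eqI[of _ _ y]) auto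
  qed
  ultimately show ?thesis by (rule continuous_on_subset)
qed

lemma eta_deriv:
  assumes x: "0 < x" "ennreal x < xstar u0 u1"
  shows "(\<eta> has_real_derivative inverse (h (\<eta> x))) (at x)"
proof -
  \<comment> \<open>A height strictly between \<open>\<eta> x\<close> and u0 gives an open interval
    around \<open>x\<close> on which the profile inverts a finite integral.\<close>
  define v where "v = (\<eta> x + u0) / 2"
  note y = eta_interior[OF x]
  have v: "\<eta> x < v" "v < u0" "v \<in> {0..u0}" using y by (auto simp: v_def)
  define b where "b = enn2real (H u0 u1 v)"
  have fin: "H u0 u1 v < \<infinity>" and b: "H u0 u1 v = ennreal b"
    using v by (simp_all add: H_less b_def)
  have "ennreal x < ennreal b"
    using H_strict_mono[of "\<eta> x" v] H_eta[of x] x y v by (simp add: b)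
  then have xb: "x < b" using x by (simp add: ennreal_less_iff)
  show ?thesis
  proof (rule DERIV_inverse_function[where a = 0 and b = b and f = "\<lambda>y. integral {0..y} h"])
    show "((\<lambda>y. integral {0..y} h) has_real_derivative h (\<eta> x)) (at (\<eta> x))"
      using y by (rule integral_h_deriv)
    show "h (\<eta> x) \<noteq> 0" using h_pos[OF y] by simp
    show "isCont \<eta> x"
      using continuous_on_interior[OF eta_cont[OF v(3) fin, folded b_def]] x xb by simp
    fix z assume z: "0 < z" "z < b"
    then have "ennreal z < H u0 u1 v"
      by (simp add: b ennreal_less_iff)
    also have "\<dots> \<le> xstar u0 u1"
      using H_mono[of v u0] v by (simp add: xstar_def)
    finally have zx: "ennreal z < xstar u0 u1" .
    then have "\<eta> z < u0" "0 < \<eta> z" using eta_interior z by auto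
    moreover have "0 \<le> integral {0..\<eta> z} h"
      using calculation set_borel_integral_eq_integral(1)[OF set_integrable_h_less[of "\<eta> z"]]
      by (intro Henstock_Kurzweil_Integration.integral_nonneg h_nonneg) auto
    ultimately show "integral {0..\<eta> z} h = z"
      using H_less[of "\<eta> z"] H_eta[of z] z zx by simp
  qed (use x xb in auto)
qed

end

section \<open>Cuspons as stationary solutions\<close>

text \<open>This is \<open>l^2 m^2\<close> as a function of \<open>v = |u|\<close>. It vanishes at
  0, the height of the cusps, and at u0, the height of the crests.\<close>

definition K :: "real \<Rightarrow> real \<Rightarrow> real \<Rightarrow> real" where
  "K u0 u1 v = v * ((u0 - v) * (u1 - v) * (u0 + u1 + v)) / 3"

lemma K_amplitudes:
  assumes "amplitudes F S u0 u1"
  shows "K u0 u1 v = 2 * \<bar>F\<bar> * v - 2 * S * v\<^sup>2 + v^4 / 3"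
proof -
  have F: "\<bar>F\<bar> = u0 * u1 * (u0 + u1) / 6" and S: "S = (u0\<^sup>2 + u0 * u1 + u1\<^sup>2) / 6"
    using assms by (auto simp: amplitudes_def)
  show ?thesis
    unfolding F S K_def by (simp add: field_simps power2_eq_square power4_eq_xxxx)
qed

context profile_function
begin

lemma K_nonneg: "v \<in> {0..u0} \<Longrightarrow> 0 \<le> K u0 u1 v"
  using u0_pos u0_le_u1 by (auto simp: K_def intro!: mult_nonneg_nonneg)

lemma K_pos: "0 < v \<Longrightarrow> v < u0 \<Longrightarrow> 0 < K u0 u1 v"
  using u0_pos u0_le_u1 by (auto simp: K_def intro!: mult_pos_pos)

lemma inverse_h: "0 < v \<Longrightarrow> v < u0 \<Longrightarrow> inverse (h v) = sqrt (K u0 u1 v) / v"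
proof -
  assume v: "0 < v" "v < u0"
  have "sqrt (K u0 u1 v) / v = sqrt (K u0 u1 v / v\<^sup>2)"
    using v by (simp add: real_sqrt_divide)
  also have "K u0 u1 v / v\<^sup>2 = inverse (3 * v / ((u0 - v) * (u1 - v) * (u0 + u1 + v)))"
    using v by (simp add: K_def power2_eq_square)
  finally show ?thesis
    by (simp only: integrand_def real_sqrt_inverse)
qed

text \<open>The function \<open>e\<close> folds the line onto the domain of the profile: \<open>\<bar>x\<bar> / l\<close> for cuspons, a
  triangle wave for periodic cuspons. Its slope is \<open>\<sigma> / l\<close>.\<close>

lemma ex_stationary:
  fixes e \<sigma> :: "real \<Rightarrow> real"
  assumes amp: "amplitudes F S u0 u1" and l: "l > 0"
    and Z: "\<And>a b. finite (Z \<inter> {a..b})"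
    and e: "continuous_on UNIV e" and eta: "continuous_on (range e) \<eta>"
    and off: "\<And>x. x \<notin> Z \<Longrightarrow> 0 < e x \<and> ennreal (e x) < xstar u0 u1"
    and e': "\<And>x. x \<notin> Z \<Longrightarrow> (e has_real_derivative \<sigma> x / l) (at x)"
    and \<sigma>: "\<And>x. x \<notin> Z \<Longrightarrow> \<bar>\<sigma> x\<bar> = 1 \<and> (\<forall>\<^sub>F y in nhds x. \<sigma> y = \<sigma> x)"
    and on: "\<And>x. x \<in> Z \<Longrightarrow> \<sigma> x = 0 \<and> \<eta> (e x) \<in> {0, u0}"
    and u: "\<And>x. u x = \<eta> (e x) * sgn F"
  obtains B m where "stationary l F S B u m Z"
proof -
  \<comment> \<open>\<open>k\<close> is \<open>l |m|\<close>, and the sign \<open>\<sigma>\<close>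
    tells whether the profile is traversed upwards or downwards.\<close>
  define k where "k x = sqrt (K u0 u1 (\<eta> (e x)))" for x
  define m where "m x = \<sigma> x * k x / l" for x
  have F: "F \<noteq> 0" using amp by (auto simp: amplitudes_def)
  have sgn: "sgn F * sgn F = 1" using F by (simp add: sgn_mult[symmetric])
  have sF: "F * sgn F = \<bar>F\<bar>" by (simp add: abs_sgn)
  have range: "\<eta> (e x) \<in> {0..u0}" for x
  proof (cases "x \<in> Z")
    case False
    then show ?thesis using eta_interior[of "e x"] off[of x] by force
  qed (use on u0_pos in force)
  have interior: "0 < \<eta> (e x)" "\<eta> (e x) < u0" if "x \<notin> Z" for x
    using eta_interior[of "e x"] off[OF that] by auto
  have eta_e: "continuous_on UNIV (\<lambda>x. \<eta> (e x))"
    by (rule continuous_on_compose2[OF eta e]) auto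
  have k_cont: "continuous_on UNIV k"
    unfolding k_def K_def by (intro continuous_intros eta_e) auto
  have k_sq: "(k x)\<^sup>2 = K u0 u1 (\<eta> (e x))" for x
    using K_nonneg[OF range[of x]] by (simp add: k_def)
  have k_pos: "0 < k x" if "x \<notin> Z" for x
    using K_pos[OF interior[OF that]] by (simp add: k_def)
  have k_nonneg: "0 \<le> k x" for x
    using K_nonneg[OF range[of x]] by (simp add: k_def)
  have k_Z: "k x = 0" if "x \<in> Z" for x
    using on[OF that] by (auto simp: k_def K_def)
  have m_le: "\<bar>m x\<bar> \<le> k x / l" for x
    using \<sigma>[of x] on[of x] l k_nonneg[of x] by (cases "x \<in> Z") (auto simp: m_def abs_mult)
  have e_eta': "((\<lambda>x. \<eta> (e x)) has_real_derivative k x / \<eta> (e x) * (\<sigma> x / l)) (at x)" if "x \<notin> Z" for x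
    using DERIV_chain2[OF eta_deriv e'[OF that]] off[OF that] inverse_h[OF interior[OF that]]
    by (simp add: k_def)
  have K_deriv: "(K u0 u1 has_real_derivative 2 * \<bar>F\<bar> - 4 * S * v + 4 * v^3 / 3) (at v)" for v
    unfolding K_amplitudes[OF amp, abs_def]
    by (auto intro!: derivative_eq_intros)
  have m': "(m has_real_derivative (F / u x - 2 * S + 2 * (u x)\<^sup>2 / 3) / l\<^sup>2) (at x)" if x: "x \<notin> Z" for x
  proof -
    let ?v = "\<eta> (e x)"
    have v: "0 < ?v" using interior[OF x] by simp
    \<comment> \<open>The slope of the profile contains \<open>k\<close>, which cancels the
      \<open>1 / k\<close> from differentiating the square root. So no square root is left in the
      derivative of \<open>m\<close>.\<close>
    have cancel: "inverse c / 2 * (A * (c / v * (s / l))) = A / (2 * v) * s / l" if "c \<noteq> 0" for A c v s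
      using that by (simp add: field_simps)
    have \<sigma>1: "\<sigma> x * \<sigma> x = 1" using \<sigma>[OF x] by (metis abs_mult_self_eq mult_1)
    have "(k has_real_derivative
        inverse (k x) / 2 * ((2 * \<bar>F\<bar> - 4 * S * ?v + 4 * ?v^3 / 3) * (k x / ?v * (\<sigma> x / l)))) (at x)"
      using DERIV_chain2[OF DERIV_real_sqrt[OF K_pos[OF interior[OF x]]] DERIV_chain2[OF K_deriv e_eta'[OF x]]]
      by (simp add: k_def[abs_def])
    also have "inverse (k x) / 2 * ((2 * \<bar>F\<bar> - 4 * S * ?v + 4 * ?v^3 / 3) * (k x / ?v * (\<sigma> x / l))) =
        (2 * \<bar>F\<bar> - 4 * S * ?v + 4 * ?v^3 / 3) / (2 * ?v) * \<sigma> x / l"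
      using cancel[of "k x"] k_pos[OF x] by simp
    also have "(2 * \<bar>F\<bar> - 4 * S * ?v + 4 * ?v^3 / 3) / (2 * ?v) = \<bar>F\<bar> / ?v - 2 * S + 2 * ?v\<^sup>2 / 3"
      using v by (simp add: field_simps power2_eq_square power3_eq_cube)
    finally have "((\<lambda>y. \<sigma> x * k y / l) has_real_derivative
        \<sigma> x * ((\<bar>F\<bar> / ?v - 2 * S + 2 * ?v\<^sup>2 / 3) * \<sigma> x / l) / l) (at x)"
      by (intro DERIV_cdivide DERIV_cmult)
    also have "\<sigma> x * ((\<bar>F\<bar> / ?v - 2 * S + 2 * ?v\<^sup>2 / 3) * \<sigma> x / l) / l =
        (\<sigma> x * \<sigma> x) * (\<bar>F\<bar> / ?v - 2 * S + 2 * ?v\<^sup>2 / 3) / l\<^sup>2"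
      by (simp add: power2_eq_square)
    also have "\<dots> = (F / u x - 2 * S + 2 * (u x)\<^sup>2 / 3) / l\<^sup>2"
    proof -
      have "F / u x = \<bar>F\<bar> / ?v"
        using v F sF by (simp add: u field_simps sgn_if)
      moreover have "(u x)\<^sup>2 = ?v\<^sup>2"
        using F by (simp add: u power_mult_distrib sgn_if)
      ultimately show ?thesis by (simp add: \<sigma>1)
    qed
    finally have d: "((\<lambda>y. \<sigma> x * k y / l) has_real_derivative
        (F / u x - 2 * S + 2 * (u x)\<^sup>2 / 3) / l\<^sup>2) (at x)" .
    \<comment> \<open>\<open>\<sigma>\<close> is constant near \<open>x\<close>, so freezing it does
      not change the derivative.\<close>
    have ev: "\<forall>\<^sub>F y in nhds x. \<sigma> x * k y / l = m y"
      using conjunct2[OF \<sigma>[OF x]] by eventually_elim (simp add: m_def)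
    show ?thesis
      using d by (subst (asm) DERIV_cong_ev[OF refl ev refl])
  qed
  have m_cont: "isCont m x" for x
  proof (cases "x \<in> Z")
    case False
    then show ?thesis using m' DERIV_isCont by blast
  next
    case True
    \<comment> \<open>\<open>\<sigma>\<close> may jump here, but \<open>m\<close> is squeezed to 0,
      since \<open>K\<close> vanishes at both admissible heights 0 and u0.\<close>
    have "isCont k x"
      using k_cont by (simp add: continuous_on_eq_continuous_at)
    then have "((\<lambda>y. k y / l) \<longlongrightarrow> k x / l) (at x)"
      by (intro tendsto_divide) (use l in \<open>auto simp: isCont_def\<close>)
    then have "((\<lambda>y. k y / l) \<longlongrightarrow> 0) (at x)" using k_Z[OF True] by simp
    then have "(m \<longlongrightarrow> 0) (at x)"
      by (rule Lim_null_comparison[rotated]) (use m_le in \<open>auto intro: always_eventually\<close>)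
    then show ?thesis using on[OF True] by (simp add: isCont_def m_def)
  qed
  have "compact (K u0 u1 ` {0..u0})"
    unfolding K_def by (intro compact_continuous_image continuous_intros) auto
  then obtain C where C: "\<And>v. v \<in> {0..u0} \<Longrightarrow> \<bar>K u0 u1 v\<bar> \<le> C"
    by (metis bounded_iff compact_imp_bounded imageI real_norm_def)
  have k_le: "k x \<le> sqrt C" for x
    unfolding k_def using C[OF range[of x]] by (intro real_sqrt_le_mono) auto
  have C0: "0 \<le> C" using C[of 0] u0_pos by auto
  define B where "B = u0 + sqrt C / l"
  have "stationary l F S B u m Z"
  proof
    show "continuous_on UNIV u"
      unfolding u by (intro continuous_intros eta_e)
    show "continuous_on UNIV m"
      using m_cont by (simp add: continuous_at_imp_continuous_on)
    fix x
    have "\<bar>u x\<bar> \<le> u0"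
      using range[of x] F by (auto simp: u abs_mult abs_sgn_eq)
    then show "\<bar>u x\<bar> \<le> B"
      using C0 l by (auto simp: B_def intro: add_increasing2)
    have "\<bar>m x\<bar> \<le> sqrt C / l"
      using m_le[of x] k_le[of x] l by (meson divide_right_mono less_imp_le order_trans)
    then show "\<bar>m x\<bar> \<le> B"
      using u0_pos by (simp add: B_def)
    have "l\<^sup>2 * (m x)\<^sup>2 = (\<sigma> x)\<^sup>2 * (k x)\<^sup>2"
      using l by (simp add: m_def power_mult_distrib power_divide)
    also have "\<dots> = (k x)\<^sup>2"
      using \<sigma>[of x] k_Z[of x] by (cases "x \<in> Z") (auto simp: abs_square_eq_1)
    also have "\<dots> = 2 * \<bar>F\<bar> * \<eta> (e x) - 2 * S * (\<eta> (e x))\<^sup>2 + (\<eta> (e x))^4 / 3"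
      by (simp add: k_sq K_amplitudes[OF amp])
    also have "\<dots> = u x * (2 * F - 2 * S * u x + (u x)^3 / 3)"
      using F by (simp add: u sgn_if abs_if algebra_simps power2_eq_square power3_eq_cube power4_eq_xxxx)
    finally show "l\<^sup>2 * (m x)\<^sup>2 = u x * (2 * F - 2 * S * u x + (u x)^3 / 3)" .
    assume x: "x \<notin> Z"
    show "u x \<noteq> 0" using interior(1)[OF x] F by (simp add: u sgn_if)
    have "(u has_real_derivative k x / \<eta> (e x) * (\<sigma> x / l) * sgn F) (at x)"
      unfolding u[abs_def] using DERIV_cmult_right[OF e_eta'[OF x]] by simp
    also have "k x / \<eta> (e x) * (\<sigma> x / l) * sgn F = m x / u x"
      using interior(1)[OF x] F l by (simp add: u m_def field_simps sgn_if)
    finally show "(u has_real_derivative m x / u x) (at x)" .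
    show "(m has_real_derivative (F / u x - 2 * S + 2 * (u x)\<^sup>2 / 3) / l\<^sup>2) (at x)"
      by (rule m'[OF x])
  qed (use l Z in auto)
  then show ?thesis by (rule that)
qed

end

lemma profile_function_amplitudes:
  "amplitudes F S u0 u1 \<Longrightarrow> profile u0 u1 \<eta> \<Longrightarrow> profile_function u0 u1 \<eta>"
  by unfold_locales (auto simp: amplitudes_def)

lemma cuspon_stationary:
  assumes l: "l > 0" and "cuspon l F S u"
  obtains B m Z where "stationary l F S B u m Z"
proof -
  obtain u0 u1 \<eta> where amp: "amplitudes F S u0 u1" and eq: "u0 = u1" and prof: "profile u0 u1 \<eta>"
    and u: "\<And>x. u x = \<eta> (\<bar>x\<bar> / l) * sgn F"
    using assms(2) by (auto simp: cuspon_def)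
  interpret profile_function u0 u1 \<eta>
    using amp prof by (rule profile_function_amplitudes)
  have inf: "xstar u0 u1 = \<infinity>" using eq by (rule xstar_infinite)
  have cont: "continuous_on {0..b} \<eta>" if b: "0 \<le> b" for b
  proof -
    obtain v where v: "0 \<le> v" "v < u0" "ennreal b \<le> H u0 u1 v"
      using H_unbounded[OF eq b] by blast
    have fin: "H u0 u1 v < \<infinity>" using v by (simp add: H_less)
    have "b \<le> enn2real (H u0 u1 v)"
      using enn2real_mono[OF v(3)] fin b by simp
    then show ?thesis
      using continuous_on_subset[OF eta_cont[of v]] v fin by auto
  qed
  have cont: "continuous_on {0..} \<eta>"
    unfolding continuous_on_eq_continuous_within
  proof
    fix x :: real assume x: "x \<in> {0..}"
    then have "continuous (at x within {0..x + 1}) \<eta>"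
      using cont[of "x + 1"] by (auto simp: continuous_on_eq_continuous_within)
    moreover have "at x within {0..x + 1} = at x within {0..}"
      by (rule at_within_nhd[of _ "{..<x + 1}"]) auto
    ultimately show "continuous (at x within {0..}) \<eta>" by (simp add: continuous_within)
  qed
  \<comment> \<open>The only exceptional point is the cusp at 0: the height u0 is not attained, and
    \<open>sgn 0 = 0\<close> is the value required of \<open>\<sigma>\<close> there.\<close>
  show ?thesis
  proof (rule ex_stationary[where u = u and Z = "{0}" and e = "\<lambda>x. \<bar>x\<bar> / l" and \<sigma> = sgn, OF amp l])
    show "continuous_on (range (\<lambda>x. \<bar>x\<bar> / l)) \<eta>"
      by (rule continuous_on_subset[OF cont]) (use l in auto)
    fix x :: real assume "x \<notin> {0}"
    then have x: "x \<noteq> 0" by simp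
    have op: "open {y. sgn y = sgn x}"
      using x by (cases x "0::real" rule: linorder_cases)
        (auto simp: sgn_1_pos sgn_1_neg greaterThan_def[symmetric] lessThan_def[symmetric])
    have "((\<lambda>y. y * sgn x) has_real_derivative sgn x) (at x)"
      by (auto intro!: derivative_eq_intros)
    then have "(abs has_real_derivative sgn x) (at x)"
      by (rule has_field_derivative_transform_within_open[OF _ op]) (auto simp: abs_sgn)
    then show "((\<lambda>x. \<bar>x\<bar> / l) has_real_derivative sgn x / l) (at x)"
      by (rule DERIV_cdivide)
    show "\<bar>sgn x\<bar> = 1 \<and> (\<forall>\<^sub>F y in nhds x. sgn y = sgn x)"
      using x op by (auto simp: abs_sgn_eq eventually_nhds)
  qed (use l u inf that in \<open>auto intro!: continuous_intros\<close>)
qed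

text \<open>For \<open>L > 0\<close> a triangle wave of period \<open>2 L\<close> that equals
  \<open>|x|\<close> on \<open>[-L, L]\<close>. Written through \<open>cos\<close>, it inherits
  periodicity and continuity, and its slope is the sign of a sine.\<close>

definition fold_period :: "real \<Rightarrow> real \<Rightarrow> real" where
  "fold_period L x = L / pi * arccos (cos (pi * x / L))"

lemma fold_period_eq:
  assumes "L > 0" "\<bar>x\<bar> \<le> L"
  shows "fold_period L x = \<bar>x\<bar>"
proof -
  have "arccos (cos (pi * x / L)) = arccos (cos \<bar>pi * x / L\<bar>)" by (simp only: cos_abs_real)
  also have "\<dots> = \<bar>pi * x / L\<bar>"
    using assms by (intro arccos_cos) (auto simp: abs_mult field_simps)
  finally show ?thesis
    using assms by (simp add: fold_period_def abs_mult)
qed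

lemma fold_period_periodic: "L > 0 \<Longrightarrow> fold_period L (x + 2 * L) = fold_period L x"
proof -
  assume "L > 0"
  then have "pi * (x + 2 * L) / L = pi * x / L + 2 * pi"
    by (simp add: field_simps)
  then show ?thesis by (simp add: fold_period_def)
qed

lemma eq_fold_period:
  assumes L: "L > 0" and per: "\<And>x. u (x + 2 * L) = u x"
    and base: "\<And>x. \<bar>x\<bar> \<le> L \<Longrightarrow> u x = g (fold_period L x)"
  shows "u x = g (fold_period L x)"
proof -
  interpret U: periodic_fun_simple u "2 * L" by unfold_locales (rule per)
  interpret V: periodic_fun_simple "fold_period L" "2 * L"
    by unfold_locales (rule fold_period_periodic[OF L])
  \<comment> \<open>Subtracting the nearest multiple of the period brings the point into
    \<open>[-L, L]\<close>.\<close>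
  define k where "k = round (x / (2 * L))"
  define y where "y = x - of_int k * (2 * L)"
  have "\<bar>of_int k - x / (2 * L)\<bar> \<le> 1 / 2"
    unfolding k_def by (rule of_int_round_abs_le)
  then have "\<bar>y\<bar> \<le> L"
    using L by (simp add: y_def abs_le_iff field_simps)
  moreover have "x = y + of_int k * (2 * L)" by (simp add: y_def)
  ultimately show ?thesis
    using base[of y] U.plus_of_int[of y k] V.plus_of_int[of y k] by simp
qed

lemma periodic_cuspon_stationary:
  assumes l: "l > 0" and "periodic_cuspon l F S u"
  obtains B m Z where "stationary l F S B u m Z"
proof -
  obtain u0 u1 \<eta> where amp: "amplitudes F S u0 u1" and less: "u0 < u1" and prof: "profile u0 u1 \<eta>"
    and base: "\<And>x. \<bar>x\<bar> \<le> enn2real (xstar u0 u1) * l \<Longrightarrow> u x = \<eta> (\<bar>x\<bar> / l) * sgn F"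
    and per: "\<And>x. u (x + 2 * enn2real (xstar u0 u1) * l) = u x"
    using assms(2) by (auto simp: periodic_cuspon_def)
  interpret profile_function u0 u1 \<eta>
    using amp prof by (rule profile_function_amplitudes)
  define X where "X = enn2real (xstar u0 u1)"
  have fin: "xstar u0 u1 < \<infinity>" using less by (rule xstar_finite)
  then have X: "xstar u0 u1 = ennreal X" and "X > 0"
    using xstar_pos by (simp_all add: X_def enn2real_positive_iff)
  define L where "L = X * l"
  have L: "L > 0" using \<open>X > 0\<close> l by (simp add: L_def)
  have u: "u x = \<eta> (fold_period L x / l) * sgn F" for x
    by (rule eq_fold_period[where g = "\<lambda>y. \<eta> (y / l) * sgn F", OF L])
      (use base per in \<open>simp_all add: X_def L_def fold_period_eq[OF L, unfolded L_def X_def] mult.assoc\<close>)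
  have cont: "continuous_on {0..X} \<eta>"
    using eta_cont[of u0] u0_pos fin by (simp add: X_def xstar_def)
  let ?t = "\<lambda>x. pi * x / L"
  have cos_less: "-1 < cos (?t x)" "cos (?t x) < 1" if "sin (?t x) \<noteq> 0" for x
  proof -
    have "(cos (?t x))\<^sup>2 < 1"
      using that sin_cos_squared_add[of "?t x"] zero_less_power2[of "sin (?t x)"] by linarith
    then have "\<bar>cos (?t x)\<bar> < 1" by (simp add: abs_square_less_1)
    then show "-1 < cos (?t x)" "cos (?t x) < 1" by auto
  qed
  \<comment> \<open>The zeros of the sine are the multiples of \<open>L\<close>: the even ones are
    cusps, where the wave is 0; the odd ones are crests, where it equals \<open>L\<close> and the
    profile has reached u0.\<close>
  show ?thesis
  proof (rule ex_stationary[where u = u and Z = "{x. sin (?t x) = 0}" and e = "\<lambda>x. fold_period L x / l"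
        and \<sigma> = "\<lambda>x. sgn (sin (?t x))", OF amp l])
    fix a b :: real
    have "{x. sin (?t x) = 0} \<inter> {a..b} \<subseteq> (\<lambda>i. of_int i * L) ` {\<lceil>a / L\<rceil>..\<lfloor>b / L\<rfloor>}"
    proof
      fix x assume x: "x \<in> {x. sin (?t x) = 0} \<inter> {a..b}"
      then obtain i :: int where "pi * x / L = of_int i * pi"
        by (auto simp: sin_zero_iff_int2)
      then have "x = of_int i * L" using L by (simp add: field_simps)
      moreover from this have "i \<in> {\<lceil>a / L\<rceil>..\<lfloor>b / L\<rfloor>}"
        using x L by (auto simp: ceiling_le_iff le_floor_iff field_simps)
      ultimately show "x \<in> (\<lambda>i. of_int i * L) ` {\<lceil>a / L\<rceil>..\<lfloor>b / L\<rfloor>}" by blast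
    qed
    then show "finite ({x. sin (?t x) = 0} \<inter> {a..b})"
      by (rule finite_subset) auto
  next
    show "continuous_on UNIV (\<lambda>x. fold_period L x / l)"
      unfolding fold_period_def using L l by (intro continuous_intros) auto
    have "fold_period L x / l \<in> {0..X}" for x
    proof -
      have "0 \<le> arccos (cos (?t x))" "arccos (cos (?t x)) \<le> pi"
        by (auto intro: arccos_lbound arccos_ubound)
      then have "0 \<le> fold_period L x" "fold_period L x \<le> L"
        using L by (auto simp: fold_period_def field_simps)
      then show ?thesis using l by (auto simp: L_def field_simps)
    qed
    then show "continuous_on (range (\<lambda>x. fold_period L x / l)) \<eta>"
      by (intro continuous_on_subset[OF cont]) auto
  next
    fix x assume "x \<notin> {x. sin (?t x) = 0}"
    then have x: "sin (?t x) \<noteq> 0" by simp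
    have "0 < arccos (cos (?t x))" "arccos (cos (?t x)) < pi"
      using arccos_lt_bounded[OF cos_less[OF x]] by auto
    then have "0 < fold_period L x" "fold_period L x < L"
      using L by (auto simp: fold_period_def field_simps)
    then show "0 < fold_period L x / l \<and> ennreal (fold_period L x / l) < xstar u0 u1"
      using l by (auto simp: X L_def ennreal_less_iff field_simps)
    \<comment> \<open>The derivative of the arc cosine contributes \<open>- 1 / |sin|\<close>, since
      \<open>1 - cos^2 = sin^2\<close>; the sine divided by its modulus is the sign
      \<open>\<sigma>\<close>.\<close>
    have "(fold_period L has_real_derivative
        L / pi * (inverse (- sqrt (1 - (cos (?t x))\<^sup>2)) * (- sin (?t x) * (pi / L)))) (at x)"
      unfolding fold_period_def
      by (intro DERIV_cmult DERIV_chain2[OF DERIV_arccos] cos_less x DERIV_chain2[OF DERIV_cos])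
        (use L in \<open>auto intro!: derivative_eq_intros\<close>)
    also have "L / pi * (inverse (- sqrt (1 - (cos (?t x))\<^sup>2)) * (- sin (?t x) * (pi / L))) = sgn (sin (?t x))"
      using L x by (simp add: sin_squared_eq[symmetric] sgn_if field_simps)
    finally show "((\<lambda>x. fold_period L x / l) has_real_derivative sgn (sin (?t x)) / l) (at x)"
      by (rule DERIV_cdivide)
    have "open {y. 0 < sin (?t y)}" "open {y. sin (?t y) < 0}"
      by (intro open_Collect_less continuous_intros; use L in simp)+
    then have "\<forall>\<^sub>F y in nhds x. sgn (sin (?t y)) = sgn (sin (?t x))"
      using x unfolding eventually_nhds
      by (cases "0 < sin (?t x)") (fastforce simp: sgn_if)+
    then show "\<bar>sgn (sin (?t x))\<bar> = 1 \<and> (\<forall>\<^sub>F y in nhds x. sgn (sin (?t y)) = sgn (sin (?t x)))"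
      using x by (simp add: abs_sgn_eq)
  next
    fix x assume "x \<in> {x. sin (?t x) = 0}"
    then have x: "sin (?t x) = 0" by simp
    then have "cos (?t x) = 1 \<or> cos (?t x) = -1"
      using sin_cos_squared_add[of "?t x"] by (auto simp: power2_eq_1_iff)
    then have "fold_period L x / l = 0 \<or> fold_period L x / l = X"
      using l by (auto simp: fold_period_def L_def)
    then show "sgn (sin (?t x)) = 0 \<and> \<eta> (fold_period L x / l) \<in> {0, u0}"
      using x eta_xstar fin by (auto simp: X_def)
  qed (use u that in auto)
qed

section \<open>Amplitudes and the inequality between the fluxes\<close>

lemma square_powr_three_halves:
  assumes "c > (0::real)"
  shows "(c\<^sup>2) powr (3 / 2) = c^3"
proof -
  have "(c\<^sup>2) powr (3 / 2) = (c powr 2) powr (3 / 2)"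
    using assms by (simp add: powr_numeral)
  also have "\<dots> = c powr 3"
    by (simp only: powr_powr) simp
  finally show ?thesis using assms by (simp add: powr_numeral)
qed

lemma amplitudes_root:
  assumes "amplitudes F S u0 u1"
  shows "u0^3 - 6 * S * u0 + 6 * \<bar>F\<bar> = 0"
proof -
  have F: "\<bar>F\<bar> = u0 * u1 * (u0 + u1) / 6" and S: "S = (u0\<^sup>2 + u0 * u1 + u1\<^sup>2) / 6"
    using assms by (auto simp: amplitudes_def)
  show ?thesis
    unfolding F S by (simp add: field_simps power2_eq_square power3_eq_cube)
qed

text \<open>The smaller amplitude is a zero of the cubic \<open>q\<close> between 0 and
  \<open>c\<close>, the minimum point of \<open>q\<close> on the positive axis. As
  \<open>q c = 2 * (3 * |F| - c^3)\<close>, the assumed inequality is precisely the sign needed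
  there.\<close>

lemma ex1_amplitudes:
  assumes S: "S \<ge> 0" and F: "0 < 3 * \<bar>F\<bar>" and FS: "3 * \<bar>F\<bar> \<le> (2 * S) powr (3 / 2)"
  shows "\<exists>!(u0, u1). amplitudes F S u0 u1"
proof -
  define q where "q v = v^3 - 6 * S * v + 6 * \<bar>F\<bar>" for v
  define c where "c = sqrt (2 * S)"
  have "S \<noteq> 0" using F FS by auto
  then have c: "c > 0" "c\<^sup>2 = 2 * S" using S by (auto simp: c_def)
  have "(2 * S) powr (3 / 2) = c^3"
    using square_powr_three_halves[OF c(1)] c(2) by simp
  then have Fc: "3 * \<bar>F\<bar> \<le> c^3" using FS by simp
  have "6 * S * c = 3 * c^3"
    by (simp add: power3_eq_cube c(2)[unfolded power2_eq_square])
  then have "q c \<le> 0"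
    using Fc by (simp add: q_def)
  moreover have "0 \<le> q 0" using F by (simp add: q_def)
  moreover have "continuous_on {0..c} q" unfolding q_def by (intro continuous_intros)
  ultimately obtain a where a: "0 \<le> a" "a \<le> c" "q a = 0"
    using IVT2'[of q c 0 0] c by auto
  have "a \<noteq> 0" using a(3) F by (auto simp: q_def)
  then have a0: "a > 0" using a by simp
  have a2: "a\<^sup>2 \<le> 2 * S" using power_mono[OF a(2,1), of 2] c by simp
  \<comment> \<open>The larger root of \<open>b^2 + a b + a^2 = 6 S\<close>; the bound
    \<open>a^2 \<le> 2 S\<close> is exactly what makes it at least \<open>a\<close>.\<close>
  define b where "b = (- a + sqrt (24 * S - 3 * a\<^sup>2)) / 2"
  have "3 * a \<le> sqrt (24 * S - 3 * a\<^sup>2)"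
    by (rule real_le_rsqrt) (use a2 in \<open>simp add: power_mult_distrib\<close>)
  then have ab: "a \<le> b" by (simp add: b_def)
  have "2 * b + a = sqrt (24 * S - 3 * a\<^sup>2)"
    by (simp add: b_def field_simps)
  then have "(2 * b + a)\<^sup>2 = 24 * S - 3 * a\<^sup>2"
    using a2 S by simp
  then have Sab: "S = (a\<^sup>2 + a * b + b\<^sup>2) / 6"
    by (simp add: power2_eq_square algebra_simps)
  have "6 * \<bar>F\<bar> = a * (6 * S - a\<^sup>2)"
    using a(3) by (simp add: q_def power2_eq_square power3_eq_cube algebra_simps)
  also have "\<dots> = a * b * (a + b)"
    by (simp add: Sab power2_eq_square algebra_simps)
  finally have "amplitudes F S a b"
    using a0 ab Sab by (simp add: amplitudes_def)
  moreover have "(x1, x2) = (y1, y2)"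
    if "amplitudes F S x1 x2" "amplitudes F S y1 y2" for x1 x2 y1 y2
  proof -
    \<comment> \<open>Two zeros \<open>x1 < y1\<close> of the cubic give
      \<open>6 S = x1^2 + x1 y1 + y1^2 < 3 y1^2\<close>, whereas \<open>y1 \<le> y2\<close> gives
      \<open>6 S \<ge> 3 y1^2\<close>.\<close>
    have less: False if "amplitudes F S x1 x2" "amplitudes F S y1 y2" "x1 < y1" for x1 x2 y1 y2
    proof -
      note d = that(1,2)[unfolded amplitudes_def]
      have qx: "x1^3 - 6 * S * x1 + 6 * \<bar>F\<bar> = 0" and qy: "y1^3 - 6 * S * y1 + 6 * \<bar>F\<bar> = 0"
        using that(1,2) amplitudes_root by blast+
      have "(x1 - y1) * (x1\<^sup>2 + x1 * y1 + y1\<^sup>2 - 6 * S) = 0"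
        using qx qy by (simp add: algebra_simps power2_eq_square power3_eq_cube)
      then have "6 * S = x1\<^sup>2 + x1 * y1 + y1\<^sup>2" using that(3) by simp
      moreover have "6 * S = y1\<^sup>2 + y1 * y2 + y2\<^sup>2" using d by simp
      moreover have "y1\<^sup>2 \<le> y1 * y2" "y1\<^sup>2 \<le> y2\<^sup>2"
        using d by (auto simp: power2_eq_square intro: mult_mono)
      moreover have "x1\<^sup>2 < y1\<^sup>2" "x1 * y1 < y1\<^sup>2"
        using d that(3) by (auto simp: power2_eq_square intro: mult_strict_mono)
      ultimately show False by linarith
    qed
    have 1: "x1 = y1" using less[OF that] less[OF that(2,1)] by (cases x1 y1 rule: linorder_cases) auto
    have "(x2 - y2) * (x1 + x2 + y2) = 0"
      using that 1 by (auto simp: amplitudes_def power2_eq_square algebra_simps)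
    moreover have "x1 + x2 + y2 > 0"
      using that by (auto simp: amplitudes_def)
    ultimately show ?thesis using 1 by simp
  qed
  ultimately show ?thesis by (intro ex1I[of _ "(a, b)"]) auto
qed

lemma amplitudes_eq_powr:
  assumes "amplitudes F S u0 u0"
  shows "3 * \<bar>F\<bar> = (2 * S) powr (3 / 2)"
proof -
  have u: "u0 > 0" and S: "2 * S = u0\<^sup>2" and F: "3 * \<bar>F\<bar> = u0^3"
    using assms by (auto simp: amplitudes_def power2_eq_square power3_eq_cube)
  show ?thesis
    unfolding S F using u by (simp add: square_powr_three_halves)
qed

text \<open>The difference \<open>(2 S)\<^sup>3 - (3 F)\<^sup>2\<close> is, up to a factor, the discriminant of the cubic
  \<open>v\<^sup>3 - 6 S v + 6 \<bar>F\<bar>\<close> with the roots \<open>u\<^sub>0\<close>, \<open>u\<^sub>1\<close>, \<open>- u\<^sub>0 - u\<^sub>1\<close>.\<close>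

lemma amplitudes_less_powr:
  assumes "amplitudes F S u0 u1" "u0 < u1"
  shows "3 * \<bar>F\<bar> < (2 * S) powr (3 / 2)"
proof -
  have u: "u0 > 0" and S: "2 * S = (u0\<^sup>2 + u0 * u1 + u1\<^sup>2) / 3" and F: "3 * \<bar>F\<bar> = u0 * u1 * (u0 + u1) / 2"
    using assms by (auto simp: amplitudes_def)
  \<comment> \<open>With \<open>c^3\<close> in place of the power 3/2, both sides can be squared and
    compared as polynomials in the amplitudes.\<close>
  define c where "c = sqrt (2 * S)"
  have "2 * S > 0" unfolding S using u assms(2) by (intro divide_pos_pos add_pos_pos) auto
  then have c: "c > 0" "c\<^sup>2 = 2 * S" by (auto simp: c_def)
  have powr: "(2 * S) powr (3 / 2) = c^3"
    using square_powr_three_halves[OF c(1)] c(2) by simp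
  have "(c^3)\<^sup>2 - (3 * \<bar>F\<bar>)\<^sup>2 = (2 * S)^3 - (3 * \<bar>F\<bar>)\<^sup>2"
    unfolding c(2)[symmetric] by (simp add: power_mult[symmetric])
  also have "\<dots> = ((u1 - u0) * (2 * u0 + u1) * (u0 + 2 * u1))\<^sup>2 / 108"
    unfolding S F by (simp add: field_simps power2_eq_square power3_eq_cube)
  also have "\<dots> > 0" using u assms(2) by simp
  finally have "(3 * \<bar>F\<bar>)\<^sup>2 < (c^3)\<^sup>2"
    by (simp only: diff_gt_0_iff_gt)
  then have "3 * \<bar>F\<bar> < c^3"
    by (rule power2_less_imp_less) (use c in simp)
  then show ?thesis
    by (simp only: powr)
qed

lemma (in stationary) u_nonzero: "\<exists>x. u x \<noteq> 0"
proof -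
  have "infinite ({0..1} - Z)"
    using Diff_infinite_finite[OF finite_Z[of 0 1], of "{0..1::real}"] by (simp add: Diff_Int infinite_Icc)
  then obtain x where "x \<notin> Z" by (metis Diff_iff finite.emptyI all_not_in_conv)
  then show ?thesis using u_nz by blast
qed

lemma (in stationary) u_bounded: "bounded (range u)"
  using u_bound by (auto simp: bounded_iff)

theorem proposition6p1:
  fixes l F S :: real
  assumes "l > 0"
    and "S \<ge> 0"
    and "0 < 3 * \<bar>F\<bar>"
    and "3 * \<bar>F\<bar> \<le> (2 * S) powr (3 / 2)"
  shows "(\<exists>!(u0, u1). amplitudes F S u0 u1) \<and>
    (\<exists>u0 u1 \<eta> u. amplitudes F S u0 u1 \<and> 0 < xstar u0 u1 \<and> profile u0 u1 \<eta> \<and>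
      bounded (range u) \<and> (\<exists>x. u x \<noteq> 0) \<and>
      weak_solution l (\<lambda>t. u) \<and> momentum_flux l u S \<and> energy_flux l u F \<and>
      (\<forall>x. ennreal \<bar>x\<bar> \<le> xstar u0 u1 * ennreal l \<longrightarrow> u x = \<eta> (\<bar>x\<bar> / l) * sgn F) \<and>
      (cuspon l F S u \<and> xstar u0 u1 = \<infinity> \<or> periodic_cuspon l F S u \<and> xstar u0 u1 < \<infinity>)) \<and>
    (\<forall>u. cuspon l F S u \<longrightarrow> 3 * \<bar>F\<bar> = (2 * S) powr (3 / 2)) \<and>
    (\<forall>u. periodic_cuspon l F S u \<longrightarrow> 3 * \<bar>F\<bar> < (2 * S) powr (3 / 2)) \<and>
    (\<forall>u. cuspon l F S u \<or> periodic_cuspon l F S u \<longrightarrow> conservative_solution l u (\<lambda>t. u))"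
proof (intro conjI allI impI)
  show ex1: "\<exists>!(u0, u1). amplitudes F S u0 u1"
    using assms(2-4) by (rule ex1_amplitudes)
  then obtain u0 u1 where amp: "amplitudes F S u0 u1" by auto
  interpret amplitude_pair u0 u1
    using amp by unfold_locales (auto simp: amplitudes_def)
  obtain \<eta> where prof: "profile u0 u1 \<eta>" using ex_profile by blast
  \<comment> \<open>Every analytic claim is drawn from this; which kind of wave \<open>u\<close> is
    matters no further for the equations.\<close>
  have stat: "\<exists>B m Z. stationary l F S B u m Z" if "cuspon l F S u \<or> periodic_cuspon l F S u" for u
    using that cuspon_stationary[OF assms(1)] periodic_cuspon_stationary[OF assms(1)] by metis
  have "\<exists>u. (\<forall>x. ennreal \<bar>x\<bar> \<le> xstar u0 u1 * ennreal l \<longrightarrow> u x = \<eta> (\<bar>x\<bar> / l) * sgn F) \<and>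
      (cuspon l F S u \<and> xstar u0 u1 = \<infinity> \<or> periodic_cuspon l F S u \<and> xstar u0 u1 < \<infinity>)"
  proof (cases "u0 = u1")
    case True
    then have "cuspon l F S (\<lambda>x. \<eta> (\<bar>x\<bar> / l) * sgn F)"
      using amp prof by (auto simp: cuspon_def)
    then show ?thesis
      using xstar_infinite[OF True] by (intro exI[of _ "\<lambda>x. \<eta> (\<bar>x\<bar> / l) * sgn F"]) auto
  next
    case False
    then have less: "u0 < u1" using u0_le_u1 by simp
    have fin: "xstar u0 u1 < \<infinity>" using less by (rule xstar_finite)
    define X where "X = enn2real (xstar u0 u1)"
    have X: "xstar u0 u1 = ennreal X" and "X > 0"
      using fin xstar_pos by (simp_all add: X_def enn2real_positive_iff)
    have L: "X * l > 0" using \<open>X > 0\<close> assms(1) by simp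
    \<comment> \<open>Composition with the triangle wave extends the prescribed formula
      periodically.\<close>
    define u where "u x = \<eta> (fold_period (X * l) x / l) * sgn F" for x
    have base: "u x = \<eta> (\<bar>x\<bar> / l) * sgn F" if "\<bar>x\<bar> \<le> X * l" for x
      using fold_period_eq[OF L that] by (simp add: u_def)
    have "u (x + 2 * X * l) = u x" for x
      using fold_period_periodic[OF L, of x] by (simp add: u_def mult.assoc)
    then have "periodic_cuspon l F S u"
      unfolding periodic_cuspon_def using amp less prof base
      by (intro exI[of _ u0] exI[of _ u1] exI[of _ \<eta>]) (auto simp: X_def)
    moreover have "u x = \<eta> (\<bar>x\<bar> / l) * sgn F" if "ennreal \<bar>x\<bar> \<le> xstar u0 u1 * ennreal l" for x
      using that \<open>X > 0\<close> assms(1) L by (intro base) (simp add: X ennreal_mult[symmetric])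
    ultimately show ?thesis using fin by blast
  qed
  then obtain u where u: "\<forall>x. ennreal \<bar>x\<bar> \<le> xstar u0 u1 * ennreal l \<longrightarrow> u x = \<eta> (\<bar>x\<bar> / l) * sgn F"
    "cuspon l F S u \<and> xstar u0 u1 = \<infinity> \<or> periodic_cuspon l F S u \<and> xstar u0 u1 < \<infinity>"
    by blast
  then obtain B m Z where "stationary l F S B u m Z" using stat by blast
  then interpret stationary l F S B u m Z .
  show "\<exists>u0 u1 \<eta> u. amplitudes F S u0 u1 \<and> 0 < xstar u0 u1 \<and> profile u0 u1 \<eta> \<and>
      bounded (range u) \<and> (\<exists>x. u x \<noteq> 0) \<and>
      weak_solution l (\<lambda>t. u) \<and> momentum_flux l u S \<and> energy_flux l u F \<and>
      (\<forall>x. ennreal \<bar>x\<bar> \<le> xstar u0 u1 * ennreal l \<longrightarrow> u x = \<eta> (\<bar>x\<bar> / l) * sgn F) \<and>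
      (cuspon l F S u \<and> xstar u0 u1 = \<infinity> \<or> periodic_cuspon l F S u \<and> xstar u0 u1 < \<infinity>)"
    by (intro exI[of _ u0] exI[of _ u1] exI[of _ \<eta>] exI[of _ u] conjI amp xstar_pos prof
        u_bounded u_nonzero weak_solution_u momentum_flux_u energy_flux_u u)
  show "conservative_solution l v (\<lambda>t. v)" if "cuspon l F S v \<or> periodic_cuspon l F S v" for v
    using stat[OF that] stationary.conservative_u by blast
next
  show "3 * \<bar>F\<bar> = (2 * S) powr (3 / 2)" if "cuspon l F S u" for u
    using that amplitudes_eq_powr by (auto simp: cuspon_def)
  show "3 * \<bar>F\<bar> < (2 * S) powr (3 / 2)" if "periodic_cuspon l F S u" for u
    using that amplitudes_less_powr by (auto simp: periodic_cuspon_def)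
qed

end
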